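(* The diffeomorphism $R^*(S^2,4)\to R_2^*(T^2,2)$ given in standard coordinates by $(\gamma,\theta)\mapsto(\alpha,\beta)=(\gamma,\theta)$ is a symplectomorphism, where $R_2^*(T^2,2)\subset R^*(T^2,2)$ carries the restriction of the canonical symplectic form of $R^*(T^2,2)$ and $R^*(S^2,4)$ carries its canonical symplectic form $d\gamma\wedge d\theta$.
   Context: Identify $SU(2)$ with the unit quaternions. $R^*(T^2,2)$ is the set of conjugacy classes $[A,B,a,b]$ of $(A,B,a,b)\in SU(2)^4$ with $ABA^{-1}B^{-1}ab=1$, $\operatorname{tr}a=\operatorname{tr}b=0$, whose entries generate a nonabelian subgroup. It is a smooth 4-manifold with canonical symplectic form $$\omega=\tfrac12(A^*\theta_{MC},B^*\bar\theta_{MC})+\tfrac12(A^*\bar\theta_{MC},B^*\theta_{MC})+\tfrac12((AB)^*\theta_{MC},(A^{-1}B^{-1})^*\bar\theta_{MC})+\tfrac12(b^*\theta_{MC},(ABA^{-1}B^{-1})^*\bar\theta_{MC}),$$ where $\theta_{MC}=g^{-1}dg$, $\bar\theta_{MC}=dg\,g^{-1}$, $(x,y)=-\frac12\operatorname{tr}(xy)$ on $\mathfrak{su}(2)$, and $(\cdot,\cdot)$ of 1-forms means the wedge product contracted with this inner product. $R_2^*(T^2,2)$ is the subset of classes of the form $A=\cos\alpha+\sin\alpha\,\mathbf k$, $B=\cos\beta+\sin\beta\,\mathbf k$, $a=b^{-1}=\mathbf i$ with $(\sin\alpha,\sin\beta)\neq(0,0)$; its coordinates $(\alpha,\beta)$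 are $2\pi$-periodic in each variable and subject to $(\alpha,\beta)\sim(-\alpha,-\beta)$. $R^*(S^2,4)$ (the pillowcase) is the set of conjugacy classes of $(a,b,c,d)\in SU(2)^4$ with $ba=cd$, all traces zero, generating a nonabelian subgroup; each class has a representative $a=\mathbf i$, $b=\cos\gamma\,\mathbf i+\sin\gamma\,\mathbf j$, $c=\cos\theta\,\mathbf i+\sin\theta\,\mathbf j$, $d=c^{-1}ba$ with $(\sin\gamma,\sin\theta)\ne(0,0)$, and $(\gamma,\theta)$ are $2\pi$-periodic and subject to $(\gamma,\theta)\sim(-\gamma,-\theta)$. Its symplectic form is taken to be $d\gamma\wedge d\theta$. *)

theory Defs
  imports "HOL-Analysis.Analysis" "HOL-Algebra.Generated_Groups"
begin

section \<open>Unit quaternions as \<open>SU(2)\<close>\<close>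

type_synonym mat2 = "complex^2^2"
type_synonym quad = "mat2 \<times> mat2 \<times> mat2 \<times> mat2"

definition ctranspose :: "mat2 \<Rightarrow> mat2" where
  "ctranspose g = (\<chi> r s. cnj (g $ s $ r))"

definition SU2 :: "mat2 set" where
  "SU2 = {g. g ** ctranspose g = mat 1 \<and> det g = 1}"

definition su2 :: "mat2 set" where
  "su2 = {\<xi>. ctranspose \<xi> = - \<xi> \<and> trace \<xi> = 0}"

definition SU2_group :: "mat2 monoid" where
  "SU2_group = \<lparr>carrier = SU2, mult = (**), one = mat 1\<rparr>"

definition qi :: mat2 where
  "qi = vector [vector [\<i>, 0], vector [0, - \<i>]]"

definition qj :: mat2 where
  "qj = vector [vector [0, 1], vector [- 1, 0]]"

definition qk :: mat2 where
  "qk = vector [vector [0, \<i>], vector [\<i>, 0]]"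

lemma quaternion_relations:
  "qi ** qi = - mat 1" "qj ** qj = - mat 1" "qk ** qk = - mat 1"
  "qi ** qj = qk" "qj ** qk = qi" "qk ** qi = qj"
  by (simp_all add: qi_def qj_def qk_def matrix_matrix_mult_def mat_def vec_eq_iff forall_2 sum_2)

lemma group_SU2: "group SU2_group"
proof (rule groupI)
  fix g h assume "g \<in> carrier SU2_group" "h \<in> carrier SU2_group"
  then have g: "g ** ctranspose g = mat 1" "det g = 1" and h: "h ** ctranspose h = mat 1" "det h = 1"
    by (auto simp: SU2_group_def SU2_def)
  have "ctranspose (g ** h) = ctranspose h ** ctranspose g"
    by (simp add: ctranspose_def matrix_matrix_mult_def vec_eq_iff sum_2 mult.commute)
  then have "(g ** h) ** ctranspose (g ** h) = g ** (h ** ctranspose h) ** ctranspose g"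
    by (simp add: matrix_mul_assoc)
  with g h show "g \<otimes>\<^bsub>SU2_group\<^esub> h \<in> carrier SU2_group"
    by (simp add: SU2_group_def SU2_def det_mul)
next
  show "\<one>\<^bsub>SU2_group\<^esub> \<in> carrier SU2_group"
    by (auto simp: SU2_group_def SU2_def ctranspose_def mat_def vec_eq_iff forall_2
        matrix_matrix_mult_def sum_2 det_2)
next
  fix g assume "g \<in> carrier SU2_group"
  then have g: "g ** ctranspose g = mat 1" "det g = 1"
    by (auto simp: SU2_group_def SU2_def)
  have gl: "ctranspose g ** g = mat 1"
    using g(1) matrix_left_right_inverse by blast
  then have "det (ctranspose g) = 1"
    using g(2) by (metis det_I det_mul mult.right_neutral)
  moreover have "ctranspose (ctranspose g) = g"
    by (simp add: ctranspose_def vec_eq_iff)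
  ultimately show "\<exists>h\<in>carrier SU2_group. h \<otimes>\<^bsub>SU2_group\<^esub> g = \<one>\<^bsub>SU2_group\<^esub>"
    using gl by (intro bexI[of _ "ctranspose g"]) (simp_all add: SU2_group_def SU2_def)
qed (auto simp: SU2_group_def matrix_mul_assoc)

definition generates_nonabelian :: "mat2 set \<Rightarrow> bool" where
  "generates_nonabelian S \<longleftrightarrow> \<not> comm_group (subgroup_generated SU2_group S)"

definition conj_act :: "mat2 \<Rightarrow> quad \<Rightarrow> quad" where
  "conj_act g = (\<lambda>(a, b, c, d).
     (g ** a ** matrix_inv g, g ** b ** matrix_inv g,
      g ** c ** matrix_inv g, g ** d ** matrix_inv g))"

definition conj_class :: "quad \<Rightarrow> quad set" where
  "conj_class x = (\<lambda>g. conj_act g x) ` SU2"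


section \<open>The moduli spaces\<close>

definition R_star_T22 :: "quad set set" where
  "R_star_T22 = {conj_class (A, B, a, b) | A B a b.
     {A, B, a, b} \<subseteq> SU2 \<and>
     A ** B ** matrix_inv A ** matrix_inv B ** a ** b = mat 1 \<and>
     trace a = 0 \<and> trace b = 0 \<and> generates_nonabelian {A, B, a, b}}"

definition R_star_S24 :: "quad set set" where
  "R_star_S24 = {conj_class (a, b, c, d) | a b c d.
     {a, b, c, d} \<subseteq> SU2 \<and> b ** a = c ** d \<and>
     trace a = 0 \<and> trace b = 0 \<and> trace c = 0 \<and> trace d = 0 \<and>
     generates_nonabelian {a, b, c, d}}"

definition coord_dom :: "(real \<times> real) set" where
  "coord_dom = {(x, y). (sin x, sin y) \<noteq> (0, 0)}"

definition torus_rep :: "real \<times> real \<Rightarrow> quad" where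
  "torus_rep = (\<lambda>(\<alpha>, \<beta>).
     (cos \<alpha> *\<^sub>R mat 1 + sin \<alpha> *\<^sub>R qk, cos \<beta> *\<^sub>R mat 1 + sin \<beta> *\<^sub>R qk, qi, matrix_inv qi))"

definition R2_star_T22 :: "quad set set" where
  "R2_star_T22 = {m \<in> R_star_T22. \<exists>u\<in>coord_dom. m = conj_class (torus_rep u)}"

definition pillow_rep :: "real \<times> real \<Rightarrow> quad" where
  "pillow_rep = (\<lambda>(\<gamma>, \<theta>).
     let a = qi; b = cos \<gamma> *\<^sub>R qi + sin \<gamma> *\<^sub>R qj; c = cos \<theta> *\<^sub>R qi + sin \<theta> *\<^sub>R qj
     in (a, b, c, matrix_inv c ** b ** a))"


section \<open>Smooth maps and tangent vectors on spaces of conjugacy classes\<close>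

text \<open>Only meaningful for open \<open>S\<close>.\<close>

primrec Ck_on :: "nat \<Rightarrow> 'a::euclidean_space set \<Rightarrow> ('a \<Rightarrow> 'b::real_normed_vector) \<Rightarrow> bool" where
  "Ck_on 0 S f \<longleftrightarrow> continuous_on S f"
| "Ck_on (Suc k) S f \<longleftrightarrow> (\<forall>x\<in>S. f differentiable (at x)) \<and>
     (\<forall>v. Ck_on k S (\<lambda>x. frechet_derivative f (at x) v))"

definition smooth_on :: "'a::euclidean_space set \<Rightarrow> ('a \<Rightarrow> 'b::real_normed_vector) \<Rightarrow> bool" where
  "smooth_on S f \<longleftrightarrow> (\<forall>k. Ck_on k S f)"

text \<open>
  A space \<open>M\<close> of conjugacy classes is a set of subsets of the real vector space \<^typ>\<open>quad\<close>, and
  \<open>\<Union>M\<close> is its preimage under \<^const>\<open>conj_class\<close>. Where this is used, \<open>\<Union>M\<close> is a submanifold on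
  which \<open>SU(2)/{1, -1}\<close> acts freely by conjugation and \<open>M\<close> has the quotient smooth structure;
  \<open>\<Union>M \<rightarrow> M\<close> is then a principal bundle. Since such a bundle has local sections, a map
  between two such quotients is smooth iff it lifts locally to a smooth map between the
  total spaces, and a map defined on a submanifold is smooth iff it locally has a smooth
  extension to the ambient space. For \<open>M \<subseteq> N\<close> the structure obtained in this way on \<open>M\<close> is
  the one of a submanifold of \<open>N\<close>.
\<close>

definition local_smooth_lift ::
    "quad set set \<Rightarrow> quad set set \<Rightarrow> (quad set \<Rightarrow> quad set) \<Rightarrow> quad set \<Rightarrow> (quad \<Rightarrow> quad) \<Rightarrow> bool" where
  "local_smooth_lift M N F U f \<longleftrightarrow> open U \<and> smooth_on U f \<and>
     (\<forall>x \<in> U \<inter> \<Union>M. f x \<in> \<Union>N \<and> conj_class (f x) = F (conj_class x))"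

definition smooth_map :: "quad set set \<Rightarrow> quad set set \<Rightarrow> (quad set \<Rightarrow> quad set) \<Rightarrow> bool" where
  "smooth_map M N F \<longleftrightarrow> F ` M \<subseteq> N \<and> (\<forall>x \<in> \<Union>M. \<exists>U f. x \<in> U \<and> local_smooth_lift M N F U f)"

definition is_diffeomorphism :: "quad set set \<Rightarrow> quad set set \<Rightarrow> (quad set \<Rightarrow> quad set) \<Rightarrow> bool" where
  "is_diffeomorphism M N F \<longleftrightarrow>
     bij_betw F M N \<and> smooth_map M N F \<and> smooth_map N M (inv_into M F)"

text \<open>The derivative at \<open>t = 0\<close> of \<open>conj_act (exp (t \<xi>)) x\<close>.\<close>

definition inf_conj :: "mat2 \<Rightarrow> quad \<Rightarrow> quad" where
  "inf_conj \<xi> = (\<lambda>(a, b, c, d).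
     (\<xi> ** a - a ** \<xi>, \<xi> ** b - b ** \<xi>, \<xi> ** c - c ** \<xi>, \<xi> ** d - d ** \<xi>))"

text \<open>
  A tangent vector of \<open>M\<close> is represented by the set of all pairs \<open>(x, v)\<close>, \<open>v\<close> tangent to \<open>\<Union>M\<close>
  at \<open>x\<close>, that are mapped to it by the derivative of \<open>\<Union>M \<rightarrow> M\<close>. This set is an orbit of the
  tangent group of \<open>SU(2)\<close>: the velocities of the curves \<open>t \<mapsto> conj_act (exp (t \<xi>) g) (c t)\<close>, if
  \<open>c\<close> is a curve with velocity \<open>(x, v)\<close>. It does not depend on \<open>M\<close>, so for \<open>M \<subseteq> N\<close> the derivative
  of the inclusion is the inclusion of tangent spaces.
\<close>

type_synonym tvec = "(quad \<times> quad) set"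

definition tangent_class :: "quad \<Rightarrow> quad \<Rightarrow> tvec" where
  "tangent_class x v =
     {(conj_act g x, conj_act g v + inf_conj \<xi> (conj_act g x)) | g \<xi>. g \<in> SU2 \<and> \<xi> \<in> su2}"

definition smooth_curve_in :: "quad set \<Rightarrow> (real \<Rightarrow> quad) \<Rightarrow> bool" where
  "smooth_curve_in X c \<longleftrightarrow> (\<exists>\<epsilon>>0. smooth_on {- \<epsilon> <..< \<epsilon>} c \<and> c ` {- \<epsilon> <..< \<epsilon>} \<subseteq> X)"

definition velocity :: "(real \<Rightarrow> quad) \<Rightarrow> tvec" where
  "velocity c = tangent_class (c 0) (vector_derivative c (at 0))"

definition tangent_space :: "quad set set \<Rightarrow> quad set \<Rightarrow> tvec set" where
  "tangent_space M m = {velocity c | c. smooth_curve_in (\<Union>M) c \<and> c 0 \<in> m}"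

text \<open>The derivative of \<open>F\<close> sends the velocity of a curve to that of its image; \<open>c\<close> and \<open>d\<close> lift
  the two curves to the total spaces.\<close>

definition tangent_map ::
    "quad set set \<Rightarrow> quad set set \<Rightarrow> (quad set \<Rightarrow> quad set) \<Rightarrow> tvec \<Rightarrow> tvec" where
  "tangent_map M N F p = (THE q. \<exists>c d. smooth_curve_in (\<Union>M) c \<and> smooth_curve_in (\<Union>N) d \<and>
     (\<forall>\<^sub>F t in nhds 0. F (conj_class (c t)) = conj_class (d t)) \<and>
     p = velocity c \<and> q = velocity d)"

type_synonym two_form = "tvec \<Rightarrow> tvec \<Rightarrow> real"

definition is_symplectomorphism ::
    "quad set set \<Rightarrow> two_form \<Rightarrow> quad set set \<Rightarrow> two_form \<Rightarrow> (quad set \<Rightarrow> quad set) \<Rightarrow> bool" where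
  "is_symplectomorphism M \<omega>\<^sub>M N \<omega>\<^sub>N F \<longleftrightarrow> is_diffeomorphism M N F \<and>
     (\<forall>m\<in>M. \<forall>p\<in>tangent_space M m. \<forall>q\<in>tangent_space M m.
        \<omega>\<^sub>N (tangent_map M N F p) (tangent_map M N F q) = \<omega>\<^sub>M p q)"


section \<open>The symplectic forms\<close>

definition su2_inner :: "mat2 \<Rightarrow> mat2 \<Rightarrow> real" where
  "su2_inner x y = Re (- (1/2) * trace (x ** y))"

text \<open>Pullbacks of the left and right invariant Maurer--Cartan forms along a map \<open>w\<close>.\<close>

definition MC_left :: "(quad \<Rightarrow> mat2) \<Rightarrow> quad \<Rightarrow> quad \<Rightarrow> mat2" where
  "MC_left w x v = matrix_inv (w x) ** frechet_derivative w (at x) v"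

definition MC_right :: "(quad \<Rightarrow> mat2) \<Rightarrow> quad \<Rightarrow> quad \<Rightarrow> mat2" where
  "MC_right w x v = frechet_derivative w (at x) v ** matrix_inv (w x)"

definition wedge_inner ::
    "(quad \<Rightarrow> quad \<Rightarrow> mat2) \<Rightarrow> (quad \<Rightarrow> quad \<Rightarrow> mat2) \<Rightarrow> quad \<Rightarrow> quad \<Rightarrow> quad \<Rightarrow> real" where
  "wedge_inner \<eta> \<zeta> x v w = su2_inner (\<eta> x v) (\<zeta> x w) - su2_inner (\<eta> x w) (\<zeta> x v)"

definition omega_total :: "quad \<Rightarrow> quad \<Rightarrow> quad \<Rightarrow> real" where
  "omega_total x v w =
     1/2 * wedge_inner (MC_left (\<lambda>(A, B, a, b). A)) (MC_right (\<lambda>(A, B, a, b). B)) x v w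
   + 1/2 * wedge_inner (MC_right (\<lambda>(A, B, a, b). A)) (MC_left (\<lambda>(A, B, a, b). B)) x v w
   + 1/2 * wedge_inner (MC_left (\<lambda>(A, B, a, b). A ** B))
             (MC_right (\<lambda>(A, B, a, b). matrix_inv A ** matrix_inv B)) x v w
   + 1/2 * wedge_inner (MC_left (\<lambda>(A, B, a, b). b))
             (MC_right (\<lambda>(A, B, a, b). A ** B ** matrix_inv A ** matrix_inv B)) x v w"

text \<open>The form on \<^const>\<open>R_star_T22\<close> whose pullback to the total space is \<^const>\<open>omega_total\<close>; for
  tangent vectors of \<^const>\<open>R2_star_T22\<close> its values are those of the restricted form.\<close>

definition torus_form :: two_form where
  "torus_form p q = (THE r. \<exists>x v w. (x, v) \<in> p \<and> (x, w) \<in> q \<and> r = omega_total x v w)"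

text \<open>The coordinate expression \<open>d\<gamma> \<and> d\<theta>\<close>: \<open>s\<close> and \<open>t\<close> are the components of \<open>p\<close> and \<open>q\<close> in the
  basis \<open>\<partial>/\<partial>\<gamma>, \<partial>/\<partial>\<theta>\<close> at \<open>u = (\<gamma>, \<theta>)\<close>.\<close>

definition pillow_form :: two_form where
  "pillow_form p q = (THE r. \<exists>u\<in>coord_dom. \<exists>s t.
     p = tangent_class (pillow_rep u) (frechet_derivative pillow_rep (at u) s) \<and>
     q = tangent_class (pillow_rep u) (frechet_derivative pillow_rep (at u) t) \<and>
     r = fst s * snd t - snd s * fst t)"

end

theory Submission
  imports Defs
begin

text \<open>
  If \<open>a = i\<close> and \<open>b = cos \<gamma> i + sin \<gamma> j\<close> then \<open>- b a = e\<^bsup>\<gamma>k\<^esup>\<close>. Hence the map is induced by the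
  equivariant polynomial map \<open>(a, b, c, d) \<mapsto> (- b a, - c a, a, - a)\<close>, whose inverse
  \<open>(A, B, a, b) \<mapsto> (a, A a, B a, - B a A a a)\<close> is polynomial as well, so it is a diffeomorphism.
  At \<open>A = e\<^bsup>\<alpha>k\<^esup>\<close>, \<open>B = e\<^bsup>\<beta>k\<^esup>\<close> the first two terms of \<open>\<omega>\<close> contribute \<open>1/2\<close> each to
  \<open>\<omega>(\<partial>\<^sub>\<alpha>, \<partial>\<^sub>\<beta>)\<close> and the last two nothing, while \<open>\<omega>\<close> vanishes on the orbit directions.
\<close>


section \<open>Calculus of smooth maps\<close>

text \<open>The work lies less in the map than in the definite descriptions behind its derivative
  and both forms, each of which needs a unique value. Three ambiguities have to be removed. (1)
  Different curves in the total space can lift one curve of conjugacy classes. At each time some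
  element conjugates one lift to the other, but a pointwise choice need not be differentiable; it is
  replaced by a matrix that is polynomial in the two lifts, always a real multiple of a conjugating
  element, and nonzero at time 0. (2) A tangent vector has many representatives over one point;
  since stabilizers act trivially, they differ only by orbit directions. (3) Coordinates on the
  pillowcase are not unique; instead of analysing the identifications, the coordinate expression is
  compared with the form on the torus side. Moreover, tangent vectors are velocities of arbitrary
  curves in the total space. That they are coordinate vectors up to orbit directions uses a division
  by sin^2 \<gamma> + sin^2 \<theta>.\<close>

lemma Ck_on_cong:
  assumes "open S" "\<And>x. x \<in> S \<Longrightarrow> f x = g x" "Ck_on k S f"
  shows "Ck_on k S g"
  using assms(2,3)
proof (induction k arbitrary: f g)
  case 0
  then show ?case by (metis Ck_on.simps(1) continuous_on_cong)
next
  case (Suc k)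
  have D: "(g has_derivative frechet_derivative f (at x)) (at x)" if "x \<in> S" for x
    using Suc.prems that
    by (auto intro: has_derivative_transform_within_open[OF _ \<open>open S\<close>] simp: frechet_derivative_works)
  have "frechet_derivative f (at x) = frechet_derivative g (at x)" if "x \<in> S" for x
    using D[OF that] by (rule frechet_derivative_at)
  then show ?case
    using D Suc.prems(2) Suc.IH[of "\<lambda>x. frechet_derivative f (at x) v" for v]
    by (auto simp: differentiable_def)
qed

lemma Ck_on_SucI:
  assumes "open S" "\<And>x. x \<in> S \<Longrightarrow> (f has_derivative f' x) (at x)" "\<And>v. Ck_on k S (\<lambda>x. f' x v)"
  shows "Ck_on (Suc k) S f"
proof -
  have "f' x = frechet_derivative f (at x)" if "x \<in> S" for x
    using assms(2)[OF that] by (rule frechet_derivative_at)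
  then have "Ck_on k S (\<lambda>x. frechet_derivative f (at x) v)" for v
    using Ck_on_cong[OF assms(1) _ assms(3)] by simp
  then show ?thesis
    using assms(2) by (auto simp: differentiable_def)
qed

lemma Ck_on_SucD:
  assumes "Ck_on (Suc k) S f"
  shows "Ck_on k S f"
  using assms
proof (induction k arbitrary: f)
  case 0
  then show ?case
    by (auto intro!: continuous_at_imp_continuous_on differentiable_imp_continuous_within)
qed auto

lemma Ck_on_has_derivative:
  "Ck_on (Suc k) S f \<Longrightarrow> x \<in> S \<Longrightarrow> (f has_derivative frechet_derivative f (at x)) (at x)"
  by (simp add: frechet_derivative_works)

lemma Ck_on_const:
  assumes "open S"
  shows "Ck_on k S (\<lambda>_. c)"
proof (induction k arbitrary: c)
  case (Suc k)
  show ?case by (rule Ck_on_SucI[OF assms has_derivative_const Suc])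
qed simp

lemma smooth_on_id:
  assumes "open S"
  shows "smooth_on S (\<lambda>x. x)"
  unfolding smooth_on_def
proof
  fix k show "Ck_on k S (\<lambda>x. x)"
    by (cases k) (auto intro!: Ck_on_SucI[OF assms has_derivative_ident] Ck_on_const assms)
qed

lemma Ck_on_linear:
  assumes "open S" "bounded_linear L" "Ck_on k S f"
  shows "Ck_on k S (\<lambda>x. L (f x))"
  using assms(3)
proof (induction k arbitrary: f)
  case 0
  then show ?case using assms(2) by (simp add: bounded_linear.continuous_on)
next
  case (Suc k)
  show ?case
    by (rule Ck_on_SucI[OF assms(1) bounded_linear.has_derivative[OF assms(2) Ck_on_has_derivative[OF Suc.prems]]])
       (use Suc in auto)
qed

lemma Ck_on_add:
  assumes "open S" "Ck_on k S f" "Ck_on k S g"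
  shows "Ck_on k S (\<lambda>x. f x + g x)"
  using assms(2,3)
proof (induction k arbitrary: f g)
  case 0
  then show ?case by (simp add: continuous_on_add)
next
  case (Suc k)
  show ?case
    by (rule Ck_on_SucI[OF assms(1) has_derivative_add[OF Ck_on_has_derivative[OF Suc.prems(1)] Ck_on_has_derivative[OF Suc.prems(2)]]])
       (use Suc in auto)
qed

lemma Ck_on_Pair:
  assumes "open S" "Ck_on k S f" "Ck_on k S g"
  shows "Ck_on k S (\<lambda>x. (f x, g x))"
  using assms(2,3)
proof (induction k arbitrary: f g)
  case 0
  then show ?case by (simp add: continuous_on_Pair)
next
  case (Suc k)
  show ?case
    by (rule Ck_on_SucI[OF assms(1) has_derivative_Pair[OF Ck_on_has_derivative[OF Suc.prems(1)] Ck_on_has_derivative[OF Suc.prems(2)]]])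
       (use Suc in auto)
qed

lemma Ck_on_bilinear:
  assumes "open S" "bounded_bilinear pr" "Ck_on k S f" "Ck_on k S g"
  shows "Ck_on k S (\<lambda>x. pr (f x) (g x))"
  using assms(3,4)
proof (induction k arbitrary: f g)
  case 0
  then show ?case using assms(2) by (simp add: bounded_bilinear.continuous_on)
next
  case (Suc k)
  show ?case
  proof (rule Ck_on_SucI[OF assms(1) bounded_bilinear.FDERIV[OF assms(2) Ck_on_has_derivative[OF Suc.prems(1)] Ck_on_has_derivative[OF Suc.prems(2)]]])
    fix v
    \<comment> \<open>The Leibniz rule keeps one factor undifferentiated, and the induction
      hypothesis asks for that factor at the lower order \<open>k\<close>.\<close>
    have "Ck_on k S f" "Ck_on k S g"
      using Suc.prems by (auto simp del: Ck_on.simps intro: Ck_on_SucD)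
    then show "Ck_on k S (\<lambda>x. pr (f x) (frechet_derivative g (at x) v) + pr (frechet_derivative f (at x) v) (g x))"
      using Suc by (intro Ck_on_add[OF assms(1)]) auto
  qed auto
qed

lemma smooth_on_linear:
  "open S \<Longrightarrow> bounded_linear L \<Longrightarrow> smooth_on S f \<Longrightarrow> smooth_on S (\<lambda>x. L (f x))"
  by (simp add: smooth_on_def Ck_on_linear)

lemma smooth_on_Pair:
  "open S \<Longrightarrow> smooth_on S f \<Longrightarrow> smooth_on S g \<Longrightarrow> smooth_on S (\<lambda>x. (f x, g x))"
  by (simp add: smooth_on_def Ck_on_Pair)

lemma smooth_on_bilinear:
  "open S \<Longrightarrow> bounded_bilinear pr \<Longrightarrow> smooth_on S f \<Longrightarrow> smooth_on S g \<Longrightarrow>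
    smooth_on S (\<lambda>x. pr (f x) (g x))"
  by (simp add: smooth_on_def Ck_on_bilinear)

lemma smooth_on_add:
  "open S \<Longrightarrow> smooth_on S f \<Longrightarrow> smooth_on S g \<Longrightarrow> smooth_on S (\<lambda>x. f x + g x)"
  by (simp add: smooth_on_def Ck_on_add)

lemma smooth_on_subset:
  assumes "smooth_on S f" "T \<subseteq> S"
  shows "smooth_on T f"
proof -
  have "Ck_on k T f" if "Ck_on k S f" for k
    using that \<open>T \<subseteq> S\<close> by (induction k arbitrary: f) (auto intro: continuous_on_subset)
  then show ?thesis using assms(1) by (simp add: smooth_on_def)
qed

lemma smooth_on_const: "open S \<Longrightarrow> smooth_on S (\<lambda>_. c)"
  by (simp add: smooth_on_def Ck_on_const)

lemma smooth_on_differentiable: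
  "smooth_on S f \<Longrightarrow> x \<in> S \<Longrightarrow> f differentiable (at x)"
  unfolding smooth_on_def by (metis Ck_on.simps(2))


section \<open>Quaternions as matrices\<close>

lemma bounded_bilinear_matrix_mult: "bounded_bilinear ((**) :: mat2 \<Rightarrow> mat2 \<Rightarrow> mat2)"
  by (rule bilinear_conv_bounded_bilinear[THEN iffD1])
     (auto simp: bilinear_def linear_iff matrix_matrix_mult_def vec_eq_iff sum_2 algebra_simps)

interpretation mmul: bounded_bilinear "(**) :: mat2 \<Rightarrow> mat2 \<Rightarrow> mat2"
  by (rule bounded_bilinear_matrix_mult)

text \<open>Real coordinates on the whole quaternion algebra, not only on its unit sphere: sums,
  products and real multiples keep this form, so matrix identities turn into polynomial identities
  between four real coefficients.\<close>

definition quat :: "real \<Rightarrow> real \<Rightarrow> real \<Rightarrow> real \<Rightarrow> mat2" where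
  "quat w x y z = w *\<^sub>R mat 1 + x *\<^sub>R qi + y *\<^sub>R qj + z *\<^sub>R qk"

lemma quat_entries:
  "quat w x y z $ 1 $ 1 = Complex w x" "quat w x y z $ 1 $ 2 = Complex y z"
  "quat w x y z $ 2 $ 1 = Complex (- y) z" "quat w x y z $ 2 $ 2 = Complex w (- x)"
  by (simp_all add: quat_def qi_def qj_def qk_def mat_def complex_eq_iff)

lemma quat_inject [simp]:
  "quat w x y z = quat w' x' y' z' \<longleftrightarrow> w = w' \<and> x = x' \<and> y = y' \<and> z = z'"
  by (auto simp: vec_eq_iff forall_2 quat_entries)

lemma quat_add [simp]: "quat w x y z + quat w' x' y' z' = quat (w + w') (x + x') (y + y') (z + z')"
  and quat_diff [simp]: "quat w x y z - quat w' x' y' z' = quat (w - w') (x - x') (y - y') (z - z')"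
  and quat_minus [simp]: "- quat w x y z = quat (- w) (- x) (- y) (- z)"
  and quat_scaleR [simp]: "r *\<^sub>R quat w x y z = quat (r * w) (r * x) (r * y) (r * z)"
  by (auto simp: vec_eq_iff forall_2 quat_entries complex_eq_iff)

lemma quat_mult [simp]:
  "quat w x y z ** quat w' x' y' z' =
    quat (w * w' - x * x' - y * y' - z * z') (w * x' + x * w' + y * z' - z * y')
         (w * y' - x * z' + y * w' + z * x') (w * z' + x * y' - y * x' + z * w')"
  by (auto simp: vec_eq_iff forall_2 quat_entries matrix_matrix_mult_def sum_2 complex_eq_iff algebra_simps)

lemma trace_quat [simp]: "trace (quat w x y z) = of_real (2 * w)"
  by (simp add: trace_def sum_2 quat_entries complex_eq_iff)

lemma ctranspose_quat [simp]: "ctranspose (quat w x y z) = quat w (- x) (- y) (- z)"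
  by (auto simp: vec_eq_iff forall_2 quat_entries ctranspose_def complex_eq_iff)

lemma det_quat [simp]: "det (quat w x y z) = of_real (w\<^sup>2 + x\<^sup>2 + y\<^sup>2 + z\<^sup>2)"
  by (simp add: det_2 quat_entries complex_eq_iff power2_eq_square)

lemma mat_1_eq_quat: "mat 1 = quat 1 0 0 0"
  and qi_eq_quat: "qi = quat 0 1 0 0"
  and qj_eq_quat: "qj = quat 0 0 1 0"
  and qk_eq_quat: "qk = quat 0 0 0 1"
  and zero_eq_quat: "(0 :: mat2) = quat 0 0 0 0"
  by (simp_all add: quat_def)

lemmas quat_consts = mat_1_eq_quat qi_eq_quat qj_eq_quat qk_eq_quat zero_eq_quat

lemma matrix_inv_unique:
  fixes A B :: "'a::field^'n^'n"
  assumes "A ** B = mat 1"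
  shows "matrix_inv A = B"
proof -
  have BA: "B ** A = mat 1" using assms matrix_left_right_inverse by blast
  have "matrix_inv A ** A = mat 1"
    unfolding matrix_inv_def using someI[of "\<lambda>B. A ** B = mat 1 \<and> B ** A = mat 1" B] assms BA by blast
  then show ?thesis
    by (metis assms matrix_mul_assoc matrix_mul_lid matrix_mul_rid)
qed

lemma matrix_inv_quat:
  assumes "w\<^sup>2 + x\<^sup>2 + y\<^sup>2 + z\<^sup>2 = 1"
  shows "matrix_inv (quat w x y z) = quat w (- x) (- y) (- z)"
  using assms by (intro matrix_inv_unique) (simp add: mat_1_eq_quat power2_eq_square algebra_simps)

text \<open>Unitarity makes the conjugate transpose an inverse, and determinant 1 makes the adjugate
  an inverse. By uniqueness they agree, so the first row determines the second.\<close>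

lemma mem_SU2_iff: "g \<in> SU2 \<longleftrightarrow> (\<exists>w x y z. g = quat w x y z \<and> w\<^sup>2 + x\<^sup>2 + y\<^sup>2 + z\<^sup>2 = 1)"
proof
  assume "g \<in> SU2"
  then have g: "g ** ctranspose g = mat 1" and d: "det g = 1"
    by (auto simp: SU2_def)
  have "ctranspose g ** g = mat 1" using g matrix_left_right_inverse by blast
  moreover define adj :: mat2 where "adj = vector [vector [g$2$2, - g$1$2], vector [- g$2$1, g$1$1]]"
  have "g ** adj = mat 1"
    using d by (auto simp: adj_def vec_eq_iff forall_2 matrix_matrix_mult_def sum_2 det_2 mat_def algebra_simps)
  ultimately have "adj = ctranspose g"
    by (metis matrix_mul_assoc matrix_mul_lid matrix_mul_rid)
  then have "adj $ 1 $ 1 = ctranspose g $ 1 $ 1" "adj $ 1 $ 2 = ctranspose g $ 1 $ 2"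
    by simp_all
  then have "g $ 2 $ 2 = cnj (g $ 1 $ 1)" "- g $ 1 $ 2 = cnj (g $ 2 $ 1)"
    by (simp_all add: adj_def ctranspose_def)
  then have eq: "g = quat (Re (g$1$1)) (Im (g$1$1)) (Re (g$1$2)) (Im (g$1$2))"
    by (auto simp: vec_eq_iff forall_2 quat_entries complex_eq_iff)
  from d have "(Re (g$1$1))\<^sup>2 + (Im (g$1$1))\<^sup>2 + (Re (g$1$2))\<^sup>2 + (Im (g$1$2))\<^sup>2 = 1"
    by (subst (asm) eq) (simp add: complex_eq_iff del: of_real_add of_real_power)
  with eq show "\<exists>w x y z. g = quat w x y z \<and> w\<^sup>2 + x\<^sup>2 + y\<^sup>2 + z\<^sup>2 = 1" by blast
next
  assume "\<exists>w x y z. g = quat w x y z \<and> w\<^sup>2 + x\<^sup>2 + y\<^sup>2 + z\<^sup>2 = 1"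
  then obtain w x y z where g: "g = quat w x y z" and n: "w\<^sup>2 + x\<^sup>2 + y\<^sup>2 + z\<^sup>2 = 1"
    by blast
  have "g ** ctranspose g = mat 1"
    using n by (simp add: g mat_1_eq_quat power2_eq_square)
  then show "g \<in> SU2"
    unfolding SU2_def g by (simp add: n del: of_real_add of_real_power)
qed

lemma mem_su2_iff: "\<xi> \<in> su2 \<longleftrightarrow> (\<exists>x y z. \<xi> = quat 0 x y z)"
proof
  assume "\<xi> \<in> su2"
  then have "ctranspose \<xi> = - \<xi>" and t: "trace \<xi> = 0"
    by (auto simp: su2_def)
  then have "ctranspose \<xi> $ i $ j = - \<xi> $ i $ j" for i j
    by simp
  from this[of 1 1] this[of 1 2] this[of 2 2]
  have "\<xi> = quat 0 (Im (\<xi>$1$1)) (Re (\<xi>$1$2)) (Im (\<xi>$1$2))"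
    using t by (simp add: vec_eq_iff forall_2 quat_entries ctranspose_def complex_eq_iff trace_def sum_2)
  then show "\<exists>x y z. \<xi> = quat 0 x y z" by blast
qed (auto simp: su2_def)

lemma SU2_inv:
  assumes "g \<in> SU2"
  shows "matrix_inv g \<in> SU2" "g ** matrix_inv g = mat 1" "matrix_inv g ** g = mat 1"
  using assms unfolding mem_SU2_iff
  by (auto simp: matrix_inv_quat mat_1_eq_quat power2_eq_square algebra_simps)

lemma SU2_one: "mat 1 \<in> SU2"
  and SU2_mult: "g \<in> SU2 \<Longrightarrow> h \<in> SU2 \<Longrightarrow> g ** h \<in> SU2"
  using group.subgroup_self[OF group_SU2, THEN subgroup.one_closed]
    group.subgroup_self[OF group_SU2, THEN subgroup.m_closed, of g h]
  by (auto simp: SU2_group_def)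


section \<open>Conjugation and tangent classes\<close>

definition mconj :: "mat2 \<Rightarrow> mat2 \<Rightarrow> mat2" where
  "mconj g a = g ** a ** matrix_inv g"

lemma conj_act_eq: "conj_act g (a, b, c, d) = (mconj g a, mconj g b, mconj g c, mconj g d)"
  by (simp add: conj_act_def mconj_def)

lemma bounded_linear_mconj: "bounded_linear (mconj g)"
  unfolding mconj_def
  by (intro bounded_linear_compose[OF mmul.bounded_linear_left] mmul.bounded_linear_right)

lemmas mconj_add = linear_add[OF bounded_linear.linear[OF bounded_linear_mconj]]
  and mconj_diff = linear_diff[OF bounded_linear.linear[OF bounded_linear_mconj]]
  and mconj_minus = linear_neg[OF bounded_linear.linear[OF bounded_linear_mconj]]

lemma mconj_mult:
  assumes "g \<in> SU2"
  shows "mconj g (a ** b) = mconj g a ** mconj g b"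
  by (metis (no_types) mconj_def matrix_mul_assoc matrix_mul_lid SU2_inv(3)[OF assms])

lemma mconj_one [simp]: "g \<in> SU2 \<Longrightarrow> mconj g (mat 1) = mat 1"
  by (simp add: mconj_def SU2_inv)

lemma matrix_inv_mult_SU2:
  assumes "g \<in> SU2" "h \<in> SU2"
  shows "matrix_inv (g ** h) = matrix_inv h ** matrix_inv g"
  by (rule matrix_inv_unique) (metis SU2_inv(2) assms matrix_mul_assoc matrix_mul_lid)

lemma mconj_mconj:
  assumes "g \<in> SU2" "h \<in> SU2"
  shows "mconj g (mconj h a) = mconj (g ** h) a"
  by (simp add: mconj_def matrix_inv_mult_SU2[OF assms] matrix_mul_assoc)

lemma mconj_one_left [simp]: "mconj (mat 1) a = a"
  by (simp add: mconj_def matrix_inv_unique)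

lemma mconj_inverse [simp]:
  assumes "g \<in> SU2"
  shows "mconj g (mconj (matrix_inv g) a) = a" "mconj (matrix_inv g) (mconj g a) = a"
  using assms by (simp_all add: mconj_mconj SU2_inv)

lemma mconj_SU2: "g \<in> SU2 \<Longrightarrow> a \<in> SU2 \<Longrightarrow> mconj g a \<in> SU2"
  by (simp add: mconj_def SU2_mult SU2_inv)

lemma trace_mconj [simp]:
  assumes "g \<in> SU2"
  shows "trace (mconj g a) = trace a"
  unfolding mconj_def by (metis SU2_inv(3)[OF assms] matrix_mul_assoc matrix_mul_lid trace_mul_sym)

lemma matrix_inv_mconj:
  assumes "g \<in> SU2" "a \<in> SU2"
  shows "matrix_inv (mconj g a) = mconj g (matrix_inv a)"
  by (rule matrix_inv_unique) (simp add: assms SU2_inv flip: mconj_mult)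

text \<open>A product of quaternions is a quaternion, and invariance of the trace removes its real
  part.\<close>

lemma mconj_su2:
  assumes "g \<in> SU2" "\<xi> \<in> su2"
  shows "mconj g \<xi> \<in> su2"
proof -
  have "\<exists>w x y z. mconj g \<xi> = quat w x y z"
    using assms unfolding mem_SU2_iff mem_su2_iff by (auto simp: mconj_def matrix_inv_quat)
  then obtain w x y z where *: "mconj g \<xi> = quat w x y z"
    by blast
  have "trace (mconj g \<xi>) = 0"
    using assms by (simp add: su2_def)
  then show ?thesis
    unfolding * mem_su2_iff by simp
qed

lemma su2_add: "\<xi> \<in> su2 \<Longrightarrow> \<eta> \<in> su2 \<Longrightarrow> \<xi> + \<eta> \<in> su2"
  and su2_uminus: "\<xi> \<in> su2 \<Longrightarrow> - \<xi> \<in> su2"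
  and su2_zero: "0 \<in> su2"
  by (auto simp: mem_su2_iff zero_eq_quat)

lemma bounded_linear_conj_act: "bounded_linear (conj_act g)"
proof -
  have "conj_act g = (\<lambda>x. (mconj g (fst x), mconj g (fst (snd x)), mconj g (fst (snd (snd x))),
      mconj g (snd (snd (snd x)))))"
    by (auto simp: conj_act_eq)
  then show ?thesis
    by (auto intro!: bounded_linear_Pair bounded_linear_compose[OF bounded_linear_mconj]
        bounded_linear_fst_comp bounded_linear_snd_comp bounded_linear_ident)
qed

lemmas conj_act_add = linear_add[OF bounded_linear.linear[OF bounded_linear_conj_act]]

lemma conj_act_conj_act:
  "g \<in> SU2 \<Longrightarrow> h \<in> SU2 \<Longrightarrow> conj_act g (conj_act h x) = conj_act (g ** h) x"
  by (cases x) (simp add: conj_act_eq mconj_mconj)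

lemma conj_act_one [simp]: "conj_act (mat 1) x = x"
  by (cases x) (simp add: conj_act_eq)

lemma conj_act_inverse [simp]:
  "g \<in> SU2 \<Longrightarrow> conj_act g (conj_act (matrix_inv g) x) = x"
  "g \<in> SU2 \<Longrightarrow> conj_act (matrix_inv g) (conj_act g x) = x"
  by (cases x; simp add: conj_act_eq)+

lemma conj_class_conj_act:
  assumes "g \<in> SU2"
  shows "conj_class (conj_act g x) = conj_class x"
proof -
  have "conj_class (conj_act g x) \<subseteq> conj_class x" if "g \<in> SU2" for g x
    using that by (auto simp: conj_class_def conj_act_conj_act SU2_mult)
  from this[OF assms] this[of "matrix_inv g" "conj_act g x"] show ?thesis
    using assms by (intro antisym) (simp_all add: SU2_inv)
qed

lemma self_in_conj_class: "x \<in> conj_class x"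
  unfolding conj_class_def using SU2_one by (metis conj_act_one imageI)

lemma conj_class_eqI: "y \<in> conj_class x \<Longrightarrow> conj_class y = conj_class x"
  by (auto simp: conj_class_conj_act conj_class_def[of x])

lemma conj_class_eqD:
  assumes "conj_class x = conj_class y"
  obtains g where "g \<in> SU2" "x = conj_act g y"
  using self_in_conj_class[of x] assms by (auto simp: conj_class_def)

section \<open>The infinitesimal action and tangent classes as orbits\<close>

lemma inf_conj_add_left: "inf_conj (\<xi> + \<eta>) x = inf_conj \<xi> x + inf_conj \<eta> x"
  by (cases x) (simp add: inf_conj_def mmul.add_left mmul.add_right)

lemma inf_conj_minus_left: "inf_conj (- \<xi>) x = - inf_conj \<xi> x"
  by (cases x) (simp add: inf_conj_def mmul.minus_left mmul.minus_right)

lemma inf_conj_zero_left [simp]: "inf_conj 0 x = 0"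
  by (cases x) (simp add: inf_conj_def mmul.zero_left mmul.zero_right zero_prod_def)

lemma conj_act_inf_conj:
  "g \<in> SU2 \<Longrightarrow> conj_act g (inf_conj \<xi> x) = inf_conj (mconj g \<xi>) (conj_act g x)"
  by (cases x) (simp add: inf_conj_def conj_act_eq mconj_diff mconj_mult)

text \<open>Pairs (g, \<xi>) compose as in the tangent group of SU(2), which gives one inclusion for
  every pair. Applied to the inverse pair, with \<xi> replaced by minus its conjugate under the
  inverse of g, the same inclusion gives the other one.\<close>

lemma tangent_class_conj_act:
  assumes g: "g \<in> SU2" and \<xi>: "\<xi> \<in> su2"
  shows "tangent_class (conj_act g x) (conj_act g v + inf_conj \<xi> (conj_act g x)) = tangent_class x v"
proof -
  have sub: "tangent_class (conj_act g x) (conj_act g v + inf_conj \<xi> (conj_act g x)) \<subseteq> tangent_class x v"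
    if g: "g \<in> SU2" and \<xi>: "\<xi> \<in> su2" for g \<xi> x v
  proof
    fix p assume "p \<in> tangent_class (conj_act g x) (conj_act g v + inf_conj \<xi> (conj_act g x))"
    then obtain h \<eta> where h: "h \<in> SU2" and \<eta>: "\<eta> \<in> su2"
      and p: "p = (conj_act h (conj_act g x), conj_act h (conj_act g v + inf_conj \<xi> (conj_act g x)) +
        inf_conj \<eta> (conj_act h (conj_act g x)))"
      unfolding tangent_class_def by blast
    have "conj_act h (conj_act g v + inf_conj \<xi> (conj_act g x)) + inf_conj \<eta> (conj_act h (conj_act g x)) =
        conj_act (h ** g) v + inf_conj (mconj h \<xi> + \<eta>) (conj_act (h ** g) x)"
      by (simp add: conj_act_add conj_act_conj_act conj_act_inf_conj inf_conj_add_left g h)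
    then have "p = (conj_act (h ** g) x, conj_act (h ** g) v + inf_conj (mconj h \<xi> + \<eta>) (conj_act (h ** g) x))"
      by (simp add: p conj_act_conj_act g h)
    moreover have "h ** g \<in> SU2" "mconj h \<xi> + \<eta> \<in> su2"
      using g h \<xi> \<eta> by (simp_all add: SU2_mult mconj_su2 su2_add)
    ultimately show "p \<in> tangent_class x v"
      unfolding tangent_class_def by blast
  qed
  let ?x = "conj_act g x" and ?v = "conj_act g v + inf_conj \<xi> (conj_act g x)"
  let ?\<eta> = "- mconj (matrix_inv g) \<xi>"
  have "conj_act (matrix_inv g) ?x = x" "conj_act (matrix_inv g) ?v + inf_conj ?\<eta> x = v"
    by (simp_all add: g conj_act_add SU2_inv conj_act_inf_conj inf_conj_minus_left)
  then have "tangent_class x v \<subseteq> tangent_class ?x ?v"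
    using sub[of "matrix_inv g" ?\<eta> ?x ?v] g \<xi> by (simp add: SU2_inv mconj_su2 su2_uminus)
  then show ?thesis using sub[OF g \<xi>] by blast
qed

lemma tangent_class_eqI:
  assumes "(x', v') \<in> tangent_class x v"
  shows "tangent_class x' v' = tangent_class x v"
proof -
  from assms obtain g \<xi> where "g \<in> SU2" "\<xi> \<in> su2" "x' = conj_act g x"
    "v' = conj_act g v + inf_conj \<xi> (conj_act g x)"
    unfolding tangent_class_def by blast
  then show ?thesis by (simp add: tangent_class_conj_act)
qed

lemma self_in_tangent_class: "(x, v) \<in> tangent_class x v"
proof -
  have "(conj_act (mat 1) x, conj_act (mat 1) v + inf_conj 0 (conj_act (mat 1) x)) \<in> tangent_class x v"
    unfolding tangent_class_def using SU2_one su2_zero by blast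
  then show ?thesis by simp
qed


section \<open>The equivariant maps between the two representation varieties\<close>

definition pillow_to_torus :: "quad \<Rightarrow> quad" where
  "pillow_to_torus = (\<lambda>(a, b, c, d). (- (b ** a), - (c ** a), a, - a))"

definition torus_to_pillow :: "quad \<Rightarrow> quad" where
  "torus_to_pillow = (\<lambda>(A, B, a, b). (a, A ** a, B ** a, - (B ** a ** (A ** a) ** a)))"

definition pillow_to_torus_deriv :: "quad \<Rightarrow> quad \<Rightarrow> quad" where
  "pillow_to_torus_deriv = (\<lambda>(a, b, c, d) (a', b', c', d').
     (- (b ** a' + b' ** a), - (c ** a' + c' ** a), a', - a'))"

lemma torus_rep_eq:
  "torus_rep (\<alpha>, \<beta>) =
    (quat (cos \<alpha>) 0 0 (sin \<alpha>), quat (cos \<beta>) 0 0 (sin \<beta>), quat 0 1 0 0, quat 0 (- 1) 0 0)"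
  by (simp add: torus_rep_def quat_consts matrix_inv_quat)

lemma pillow_rep_eq:
  "pillow_rep (\<gamma>, \<theta>) =
    (quat 0 1 0 0, quat 0 (cos \<gamma>) (sin \<gamma>) 0, quat 0 (cos \<theta>) (sin \<theta>) 0,
     quat 0 (cos \<theta> * cos \<gamma> + sin \<theta> * sin \<gamma>) (sin \<theta> * cos \<gamma> - cos \<theta> * sin \<gamma>) 0)"
  by (simp add: pillow_rep_def quat_consts matrix_inv_quat)

lemma pillow_to_torus_rep: "pillow_to_torus (pillow_rep u) = torus_rep u"
  by (cases u) (simp add: pillow_to_torus_def pillow_rep_eq torus_rep_eq)

lemma torus_to_pillow_rep: "torus_to_pillow (torus_rep u) = pillow_rep u"
  by (cases u) (simp add: torus_to_pillow_def pillow_rep_eq torus_rep_eq)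

lemma pillow_to_torus_conj_act:
  "g \<in> SU2 \<Longrightarrow> pillow_to_torus (conj_act g x) = conj_act g (pillow_to_torus x)"
  by (cases x) (simp add: pillow_to_torus_def conj_act_eq mconj_mult mconj_minus)

lemma torus_to_pillow_conj_act:
  "g \<in> SU2 \<Longrightarrow> torus_to_pillow (conj_act g x) = conj_act g (torus_to_pillow x)"
  by (cases x) (simp add: torus_to_pillow_def conj_act_eq mconj_mult mconj_minus)

lemma has_derivative_pillow_to_torus:
  "(pillow_to_torus has_derivative pillow_to_torus_deriv x) (at x)"
proof -
  have f: "pillow_to_torus = (\<lambda>x. (- (fst (snd x) ** fst x), - (fst (snd (snd x)) ** fst x), fst x, - fst x))"
    by (auto simp: pillow_to_torus_def)
  have f': "pillow_to_torus_deriv x = (\<lambda>v. (- (fst (snd x) ** fst v + fst (snd v) ** fst x),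
      - (fst (snd (snd x)) ** fst v + fst (snd (snd v)) ** fst x), fst v, - fst v))"
    by (cases x) (auto simp: pillow_to_torus_deriv_def)
  show ?thesis
    unfolding f' by (subst f) (intro has_derivative_Pair has_derivative_minus mmul.FDERIV
        has_derivative_fst has_derivative_snd has_derivative_ident)
qed

lemma smooth_on_pillow_to_torus:
  assumes "open S" "smooth_on S f"
  shows "smooth_on S (\<lambda>x. pillow_to_torus (f x))"
proof -
  have "(\<lambda>x. pillow_to_torus (f x)) =
      (\<lambda>x. (- (fst (snd (f x)) ** fst (f x)), - (fst (snd (snd (f x))) ** fst (f x)), fst (f x), - fst (f x)))"
    by (auto simp: pillow_to_torus_def split: prod.split)
  then show ?thesis
    by (auto intro!: smooth_on_Pair smooth_on_bilinear[OF _ bounded_bilinear_matrix_mult]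
        smooth_on_linear[OF _ bounded_linear_fst] smooth_on_linear[OF _ bounded_linear_snd]
        smooth_on_linear[OF _ bounded_linear_minus[OF bounded_linear_ident]] assms)
qed

lemma smooth_on_torus_to_pillow:
  assumes "open S" "smooth_on S f"
  shows "smooth_on S (\<lambda>x. torus_to_pillow (f x))"
proof -
  have "(\<lambda>x. torus_to_pillow (f x)) = (\<lambda>x. (fst (snd (snd (f x))),
      fst (f x) ** fst (snd (snd (f x))), fst (snd (f x)) ** fst (snd (snd (f x))),
      - (fst (snd (f x)) ** fst (snd (snd (f x))) ** (fst (f x) ** fst (snd (snd (f x)))) ** fst (snd (snd (f x))))))"
    by (auto simp: torus_to_pillow_def split: prod.split)
  then show ?thesis
    by (auto intro!: smooth_on_Pair smooth_on_bilinear[OF _ bounded_bilinear_matrix_mult]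
        smooth_on_linear[OF _ bounded_linear_fst] smooth_on_linear[OF _ bounded_linear_snd]
        smooth_on_linear[OF _ bounded_linear_minus[OF bounded_linear_ident]] assms)
qed

text \<open>This is equivariance in differentiated form. Since the commutator with \<xi> is a
  derivation, the derivative of a product map sends orbit directions to orbit directions, and so it
  descends to tangent classes.\<close>

lemma pillow_to_torus_deriv_tangent_class:
  assumes "(x', v') \<in> tangent_class x v"
  shows "(pillow_to_torus x', pillow_to_torus_deriv x' v') \<in>
    tangent_class (pillow_to_torus x) (pillow_to_torus_deriv x v)"
proof -
  from assms obtain g \<xi> where g: "g \<in> SU2" and \<xi>: "\<xi> \<in> su2" and x': "x' = conj_act g x"
    and v': "v' = conj_act g v + inf_conj \<xi> x'"
    by (auto simp: tangent_class_def)
  have "pillow_to_torus_deriv x' (conj_act g v + inf_conj \<xi> x') =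
      conj_act g (pillow_to_torus_deriv x v) + inf_conj \<xi> (pillow_to_torus x')"
    by (cases x; cases v)
       (simp add: x' pillow_to_torus_deriv_def pillow_to_torus_def conj_act_eq inf_conj_def
         mconj_mult[OF g] mconj_add mconj_diff mconj_minus mmul.add_left mmul.add_right mmul.diff_left
         mmul.diff_right mmul.minus_left mmul.minus_right matrix_mul_assoc)
  then show ?thesis
    using g \<xi> by (auto simp: tangent_class_def x' v' pillow_to_torus_conj_act)
qed

lemma pillow_to_torus_deriv_cong:
  assumes "tangent_class x v = tangent_class x' v'"
  shows "tangent_class (pillow_to_torus x) (pillow_to_torus_deriv x v) =
    tangent_class (pillow_to_torus x') (pillow_to_torus_deriv x' v')"
  using assms self_in_tangent_class pillow_to_torus_deriv_tangent_class tangent_class_eqI by metis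


section \<open>Normal forms\<close>

text \<open>Centralizers are subgroups, and this is used twice: the centralizer of S contains S,
  hence all that S generates; therefore the centralizer of the generated subgroup contains S, hence
  again all that S generates.\<close>

lemma comm_group_subgroup_generated:
  assumes "group G" "S \<subseteq> carrier G"
    and comm: "\<And>x y. x \<in> S \<Longrightarrow> y \<in> S \<Longrightarrow> x \<otimes>\<^bsub>G\<^esub> y = y \<otimes>\<^bsub>G\<^esub> x"
  shows "comm_group (subgroup_generated G S)"
proof -
  interpret group G by fact
  have centralizer: "subgroup {z \<in> carrier G. \<forall>y\<in>T. z \<otimes>\<^bsub>G\<^esub> y = y \<otimes>\<^bsub>G\<^esub> z} G"
    if "T \<subseteq> carrier G" for T
  proof (rule subgroupI)
    fix a assume a: "a \<in> {z \<in> carrier G. \<forall>y\<in>T. z \<otimes>\<^bsub>G\<^esub> y = y \<otimes>\<^bsub>G\<^esub> z}"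
    have "inv\<^bsub>G\<^esub> a \<otimes>\<^bsub>G\<^esub> y = y \<otimes>\<^bsub>G\<^esub> inv\<^bsub>G\<^esub> a" if "y \<in> T" for y
    proof -
      have y: "y \<in> carrier G" "a \<otimes>\<^bsub>G\<^esub> y = y \<otimes>\<^bsub>G\<^esub> a" using a that \<open>T \<subseteq> carrier G\<close> by auto
      then show ?thesis using a by (metis (no_types, lifting) inv_closed inv_solve_left inv_solve_right m_assoc m_closed mem_Collect_eq)
    qed
    then show "inv\<^bsub>G\<^esub> a \<in> {z \<in> carrier G. \<forall>y\<in>T. z \<otimes>\<^bsub>G\<^esub> y = y \<otimes>\<^bsub>G\<^esub> z}" using a by auto
  next
    fix a b assume "a \<in> {z \<in> carrier G. \<forall>y\<in>T. z \<otimes>\<^bsub>G\<^esub> y = y \<otimes>\<^bsub>G\<^esub> z}"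
      "b \<in> {z \<in> carrier G. \<forall>y\<in>T. z \<otimes>\<^bsub>G\<^esub> y = y \<otimes>\<^bsub>G\<^esub> z}"
    then show "a \<otimes>\<^bsub>G\<^esub> b \<in> {z \<in> carrier G. \<forall>y\<in>T. z \<otimes>\<^bsub>G\<^esub> y = y \<otimes>\<^bsub>G\<^esub> z}"
      using that by (auto simp: m_assoc subset_iff) (metis m_assoc)
  qed (use that in \<open>auto intro!: exI[of _ "\<one>\<^bsub>G\<^esub>"]\<close>)
  have gen: "generate G S \<subseteq> {z \<in> carrier G. \<forall>y\<in>T. z \<otimes>\<^bsub>G\<^esub> y = y \<otimes>\<^bsub>G\<^esub> z}"
    if "T \<subseteq> carrier G" "\<And>x y. x \<in> S \<Longrightarrow> y \<in> T \<Longrightarrow> x \<otimes>\<^bsub>G\<^esub> y = y \<otimes>\<^bsub>G\<^esub> x" for T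
    using assms(2) that by (intro generate_subgroup_incl centralizer) auto
  have "generate G S \<subseteq> carrier G" using assms(2) by (rule generate_incl)
  have "x \<otimes>\<^bsub>G\<^esub> y = y \<otimes>\<^bsub>G\<^esub> x" if "x \<in> generate G S" "y \<in> generate G S" for x y
    using gen[of "generate G S"] gen[OF assms(2) comm] \<open>generate G S \<subseteq> carrier G\<close> that
    by (auto simp: subset_iff)
  moreover have "carrier G \<inter> S = S" using assms(2) by auto
  ultimately show ?thesis
    by (intro group.group_comm_groupI group_subgroup_generated)
       (auto simp: carrier_subgroup_generated)
qed

text \<open>Reduces the condition on the generated subgroup to a finite check on the four entries of
  a quadruple.\<close>

lemma generates_nonabelian_iff:
  assumes "S \<subseteq> SU2"
  shows "generates_nonabelian S \<longleftrightarrow> (\<exists>x\<in>S. \<exists>y\<in>S. x ** y \<noteq> y ** x)"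
proof
  assume gen: "generates_nonabelian S"
  show "\<exists>x\<in>S. \<exists>y\<in>S. x ** y \<noteq> y ** x"
  proof (rule ccontr)
    assume "\<not> ?thesis"
    then have comm: "x \<otimes>\<^bsub>SU2_group\<^esub> y = y \<otimes>\<^bsub>SU2_group\<^esub> x" if "x \<in> S" "y \<in> S" for x y
      unfolding SU2_group_def monoid.select_convs using that by blast
    have sub: "S \<subseteq> carrier SU2_group"
      using assms by (simp add: SU2_group_def)
    show False
      using gen comm_group_subgroup_generated[OF group_SU2 sub comm] unfolding generates_nonabelian_def by blast
  qed
next
  interpret group SU2_group by (rule group_SU2)
  assume "\<exists>x\<in>S. \<exists>y\<in>S. x ** y \<noteq> y ** x"
  then obtain x y where xy: "x \<in> S" "y \<in> S" "x ** y \<noteq> y ** x" by blast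
  have "x \<in> carrier (subgroup_generated SU2_group S)" "y \<in> carrier (subgroup_generated SU2_group S)"
    using assms xy by (auto simp: carrier_subgroup_generated SU2_group_def intro!: generate.incl)
  moreover have "x \<otimes>\<^bsub>subgroup_generated SU2_group S\<^esub> y \<noteq> y \<otimes>\<^bsub>subgroup_generated SU2_group S\<^esub> x"
    using xy by (simp add: SU2_group_def)
  ultimately show "generates_nonabelian S"
    unfolding generates_nonabelian_def using comm_groupE(4)[of "subgroup_generated SU2_group S" x y] by blast
qed

section \<open>Conjugating a quadruple into standard position\<close>

lemma SU2_trace_0:
  assumes "a \<in> SU2" "trace a = 0"
  obtains x y z where "a = quat 0 x y z" "x\<^sup>2 + y\<^sup>2 + z\<^sup>2 = 1"
  using assms by (auto simp: mem_SU2_iff)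

lemma quat_in_SU2 [simp]: "quat w x y z \<in> SU2 \<longleftrightarrow> w\<^sup>2 + x\<^sup>2 + y\<^sup>2 + z\<^sup>2 = 1"
  by (auto simp: mem_SU2_iff)

lemma mconj_quat:
  assumes "w\<^sup>2 + x\<^sup>2 + y\<^sup>2 + z\<^sup>2 = 1"
  shows "mconj (quat w x y z) a = quat w x y z ** a ** quat w (- x) (- y) (- z)"
  using assms by (simp add: mconj_def matrix_inv_quat)

lemma mconj_eqI:
  assumes "g \<in> SU2" "a ** g = g ** b"
  shows "mconj g b = a"
  unfolding mconj_def by (metis assms matrix_mul_assoc matrix_mul_rid SU2_inv(2))

text \<open>The quaternion \<open>1 - a i\<close> intertwines \<open>i\<close> and \<open>a\<close>; it vanishes only for \<open>a = - i\<close>.\<close>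

lemma ex_conj_to_qi:
  assumes "x\<^sup>2 + y\<^sup>2 + z\<^sup>2 = 1"
  obtains g where "g \<in> SU2" "mconj g (quat 0 1 0 0) = quat 0 x y z"
proof (cases "x = - 1")
  case True
  then have "y = 0" "z = 0" using assms by (auto simp: sum_power2_eq_zero_iff)
  then show ?thesis
    using True by (intro that[of "quat 0 0 1 0"]) (auto simp: mconj_quat)
next
  case False
  have "x\<^sup>2 \<le> 1\<^sup>2" using assms by (smt (verit) zero_le_power2 one_power2)
  then have "\<bar>x\<bar> \<le> 1" by (metis abs_1 abs_le_square_iff)
  then have pos: "0 < 2 + 2 * x" using False by auto
  \<comment> \<open>The squared norm of 1 - a i is (1 + x)^2 + y^2 + z^2 = 2 + 2 x, so
    \<open>r\<close> normalizes it to a unit quaternion.\<close>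
  define r where "r = 1 / sqrt (2 + 2 * x)"
  have r: "r\<^sup>2 * (2 + 2 * x) = 1" using pos by (simp add: r_def power_divide)
  define g where "g = quat (r * (1 + x)) 0 (- r * z) (r * y)"
  have "(r * (1 + x))\<^sup>2 + (- r * z)\<^sup>2 + (r * y)\<^sup>2 = r\<^sup>2 * ((1 + x)\<^sup>2 + (1 - x\<^sup>2))"
    using assms by algebra
  also have "\<dots> = 1" using r by (simp add: power2_eq_square algebra_simps)
  finally have g: "g \<in> SU2" by (simp add: g_def)
  moreover have "quat 0 x y z ** g = g ** quat 0 1 0 0"
    unfolding g_def using assms by simp algebra
  ultimately show ?thesis using that mconj_eqI by blast
qed

text \<open>A vanishing determinant makes the two plane vectors parallel. The angle is read off from
  one that is nonzero, which forces the case split; \<open>r\<close> and \<open>s\<close> are signed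
  lengths along that direction.\<close>

lemma ex_common_direction:
  fixes y z y' z' :: real
  assumes "y * z' = z * y'"
  obtains r s \<phi> where "y = r * cos \<phi>" "z = r * sin \<phi>" "y' = s * cos \<phi>" "z' = s * sin \<phi>"
proof (cases "y = 0 \<and> z = 0")
  case True
  define s where "s = sqrt (y'\<^sup>2 + z'\<^sup>2)"
  show ?thesis
  proof (cases "y' = 0 \<and> z' = 0")
    case True then show ?thesis using \<open>y = 0 \<and> z = 0\<close> by (intro that[of 0 0 0]) auto
  next
    case False
    then have "s \<noteq> 0" by (auto simp: s_def sum_power2_eq_zero_iff)
    then have "(y' / s)\<^sup>2 + (z' / s)\<^sup>2 = 1" by (auto simp: power_divide s_def simp flip: add_divide_distrib)
    then obtain \<phi> where "y' / s = cos \<phi>" "z' / s = sin \<phi>" by (metis sincos_total_2pi)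
    then show ?thesis using True \<open>s \<noteq> 0\<close> by (intro that[of 0 \<phi> s]) (auto simp: field_simps)
  qed
next
  case False
  define r where "r = sqrt (y\<^sup>2 + z\<^sup>2)"
  have "r \<noteq> 0" using False by (auto simp: r_def sum_power2_eq_zero_iff)
  have r2: "r\<^sup>2 = y\<^sup>2 + z\<^sup>2" by (simp add: r_def)
  have "(y / r)\<^sup>2 + (z / r)\<^sup>2 = 1" using \<open>r \<noteq> 0\<close> by (auto simp: power_divide r2[symmetric] simp flip: add_divide_distrib)
  then obtain \<phi> where \<phi>: "y / r = cos \<phi>" "z / r = sin \<phi>" by (metis sincos_total_2pi)
  have yz: "y = r * cos \<phi>" "z = r * sin \<phi>" using \<phi> \<open>r \<noteq> 0\<close> by (auto simp: field_simps)
  define s where "s = y' * cos \<phi> + z' * sin \<phi>"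
  have "r * (cos \<phi> * z') = r * (sin \<phi> * y')" using assms unfolding yz by (simp add: mult.assoc)
  then have *: "cos \<phi> * z' = sin \<phi> * y'" using \<open>r \<noteq> 0\<close> by simp
  have "y' = s * cos \<phi>" "z' = s * sin \<phi>"
    unfolding s_def using * sin_cos_squared_add[of \<phi>] by algebra+
  with yz that show ?thesis by blast
qed

text \<open>After a has been moved to i, the condition that d has trace zero says that i, b and c
  are coplanar. A rotation about i, which fixes a, then turns their plane into the plane of i and
  j.\<close>

lemma pillow_normal_form:
  assumes "{a, b, c, d} \<subseteq> SU2" and rel: "b ** a = c ** d"
    and tr: "trace a = 0" "trace b = 0" "trace c = 0" "trace d = 0"
  obtains h u where "h \<in> SU2" "(a, b, c, d) = conj_act h (pillow_rep u)"
proof -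
  obtain a1 a2 a3 where a: "a = quat 0 a1 a2 a3" "a1\<^sup>2 + a2\<^sup>2 + a3\<^sup>2 = 1"
    using SU2_trace_0 assms by (metis insert_subset)
  obtain g where g: "g \<in> SU2" and ga: "mconj g (quat 0 1 0 0) = a"
    using ex_conj_to_qi a by metis
  define b' c' d' where bcd': "b' = mconj (matrix_inv g) b" "c' = mconj (matrix_inv g) c" "d' = mconj (matrix_inv g) d"
  have SU: "b' \<in> SU2" "c' \<in> SU2" "d' \<in> SU2" and tr': "trace b' = 0" "trace c' = 0" "trace d' = 0"
    using assms g by (auto simp: bcd' mconj_SU2 SU2_inv)
  have g_eq: "b = mconj g b'" "c = mconj g c'" "d = mconj g d'"
    using g by (simp_all add: bcd')
  have "mconj g (b' ** quat 0 1 0 0) = mconj g (c' ** d')"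
    using rel g by (simp add: mconj_mult flip: ga g_eq)
  then have "mconj (matrix_inv g) (mconj g (b' ** quat 0 1 0 0)) = mconj (matrix_inv g) (mconj g (c' ** d'))"
    by simp
  then have rel': "b' ** quat 0 1 0 0 = c' ** d'" using g by simp
  obtain b1 b2 b3 where b': "b' = quat 0 b1 b2 b3" and bn: "b1\<^sup>2 + b2\<^sup>2 + b3\<^sup>2 = 1"
    using SU2_trace_0 SU tr' by metis
  obtain c1 c2 c3 where c': "c' = quat 0 c1 c2 c3" and cn: "c1\<^sup>2 + c2\<^sup>2 + c3\<^sup>2 = 1"
    using SU2_trace_0 SU tr' by metis
  have "quat 0 (- c1) (- c2) (- c3) ** (c' ** d') = d'"
    using cn by (simp add: c' matrix_mul_assoc power2_eq_square flip: mat_1_eq_quat)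
  then have d': "d' = quat 0 (- c1) (- c2) (- c3) ** (b' ** quat 0 1 0 0)"
    using rel' by simp
  \<comment> \<open>The real part of \<open>d'\<close> is, up to sign, the determinant of the
    vectors i, \<open>b'\<close>, \<open>c'\<close>, and it vanishes because \<open>d'\<close> has
    trace zero.\<close>
  then have "b2 * c3 = b3 * c2" using tr'(3) by (simp add: b' complex_eq_iff algebra_simps)
  then obtain r s \<phi> where rs: "b2 = r * cos \<phi>" "b3 = r * sin \<phi>" "c2 = s * cos \<phi>" "c3 = s * sin \<phi>"
    using ex_common_direction by metis
  have trig: "x\<^sup>2 + (t * cos \<phi>)\<^sup>2 + (t * sin \<phi>)\<^sup>2 = x\<^sup>2 + t\<^sup>2" for x t
    using sin_cos_squared_add[of \<phi>] by algebra
  have "b1\<^sup>2 + r\<^sup>2 = 1" "c1\<^sup>2 + s\<^sup>2 = 1"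
    using bn cn unfolding rs trig by auto
  then obtain \<gamma> \<theta> where \<gamma>: "b1 = cos \<gamma>" "r = sin \<gamma>" and \<theta>: "c1 = cos \<theta>" "s = sin \<theta>"
    by (metis sincos_total_2pi)
  \<comment> \<open>Conjugation by cos (\<phi>/2) + sin (\<phi>/2) i rotates by \<phi> about i,
    hence the half angle.\<close>
  define C S where CS: "C = cos (\<phi> / 2)" "S = sin (\<phi> / 2)"
  have CS1: "C\<^sup>2 + S\<^sup>2 = 1" by (simp add: CS)
  have \<phi>: "cos \<phi> = C\<^sup>2 - S\<^sup>2" "sin \<phi> = 2 * S * C"
    using cos_double[of "\<phi> / 2"] sin_double[of "\<phi> / 2"] by (simp_all add: CS)
  define k where "k = quat C S 0 0"
  have k: "k \<in> SU2" using CS1 by (simp add: k_def)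
  have rot: "mconj k (quat 0 x y 0) = quat 0 x (y * cos \<phi>) (y * sin \<phi>)" for x y
    unfolding \<phi> k_def using CS1 by (simp add: mconj_quat power2_eq_square) algebra
  have bk: "mconj k (quat 0 (cos \<gamma>) (sin \<gamma>) 0) = b'" and ck: "mconj k (quat 0 (cos \<theta>) (sin \<theta>) 0) = c'"
    and ik: "mconj k (quat 0 1 0 0) = quat 0 1 0 0"
    using rot[of 1 0] by (simp_all add: rot b' c' rs \<gamma> \<theta>)
  have "d' = - (mconj k (quat 0 (cos \<theta>) (sin \<theta>) 0) ** (mconj k (quat 0 (cos \<gamma>) (sin \<gamma>) 0) ** mconj k (quat 0 1 0 0)))"
    unfolding bk ck ik d' by (simp add: b' c')
  then have "d' = mconj k (- (quat 0 (cos \<theta>) (sin \<theta>) 0 ** (quat 0 (cos \<gamma>) (sin \<gamma>) 0 ** quat 0 1 0 0)))"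
    using k by (simp only: mconj_minus mconj_mult)
  then have dk: "mconj k (quat 0 (cos \<theta> * cos \<gamma> + sin \<theta> * sin \<gamma>) (sin \<theta> * cos \<gamma> - cos \<theta> * sin \<gamma>) 0) = d'"
    by (simp add: add.commute)
  have "(a, b, c, d) = conj_act g (conj_act k (pillow_rep (\<gamma>, \<theta>)))"
    by (simp only: pillow_rep_eq conj_act_eq bk ck ik dk ga g_eq)
  then have "(a, b, c, d) = conj_act (g ** k) (pillow_rep (\<gamma>, \<theta>))"
    using g k by (simp add: conj_act_conj_act)
  then show ?thesis using that g k SU2_mult by blast
qed

section \<open>Standard coordinates on the two spaces\<close>

lemma commute_mconj_iff:
  assumes "h \<in> SU2"
  shows "mconj h a ** mconj h b = mconj h b ** mconj h a \<longleftrightarrow> a ** b = b ** a"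
  using assms by (metis mconj_mult mconj_inverse(2))

lemma pillow_class:
  assumes "u \<in> coord_dom"
  shows "conj_class (pillow_rep u) \<in> R_star_S24"
proof -
  obtain \<gamma> \<theta> where u: "u = (\<gamma>, \<theta>)" by (cases u)
  have n: "(cos \<theta> * cos \<gamma> + sin \<theta> * sin \<gamma>)\<^sup>2 + (sin \<theta> * cos \<gamma> - cos \<theta> * sin \<gamma>)\<^sup>2 = 1"
    using sin_cos_squared_add[of \<theta>] sin_cos_squared_add[of \<gamma>] by algebra
  define d where "d = quat 0 (cos \<theta> * cos \<gamma> + sin \<theta> * sin \<gamma>) (sin \<theta> * cos \<gamma> - cos \<theta> * sin \<gamma>) 0"
  have SU: "{quat 0 1 0 0, quat 0 (cos \<gamma>) (sin \<gamma>) 0, quat 0 (cos \<theta>) (sin \<theta>) 0, d} \<subseteq> SU2"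
    using n by (simp add: d_def)
  have "generates_nonabelian {quat 0 1 0 0, quat 0 (cos \<gamma>) (sin \<gamma>) 0, quat 0 (cos \<theta>) (sin \<theta>) 0, d}"
    unfolding generates_nonabelian_iff[OF SU] using assms by (auto simp: coord_dom_def u)
  moreover have "quat 0 (cos \<gamma>) (sin \<gamma>) 0 ** quat 0 1 0 0 = quat 0 (cos \<theta>) (sin \<theta>) 0 ** d"
    unfolding d_def using sin_cos_squared_add[of \<theta>] by (simp, intro conjI; algebra)
  moreover have "trace d = 0" by (simp add: d_def)
  moreover have "pillow_rep u = (quat 0 1 0 0, quat 0 (cos \<gamma>) (sin \<gamma>) 0, quat 0 (cos \<theta>) (sin \<theta>) 0, d)"
    by (simp add: u pillow_rep_eq d_def)
  ultimately show ?thesis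
    unfolding R_star_S24_def using SU by fastforce
qed

text \<open>A and B lie on the circle through 1 and k, so their commutator is 1 and the relation
  reduces to a b = 1. The entry i fails to commute with A or with B as soon as the corresponding
  sine is nonzero.\<close>

lemma torus_class:
  assumes "u \<in> coord_dom"
  shows "conj_class (torus_rep u) \<in> R2_star_T22"
proof -
  obtain \<alpha> \<beta> where u: "u = (\<alpha>, \<beta>)" by (cases u)
  define A B where AB: "A = quat (cos \<alpha>) 0 0 (sin \<alpha>)" "B = quat (cos \<beta>) 0 0 (sin \<beta>)"
  have SU: "{A, B, quat 0 1 0 0, quat 0 (- 1) 0 0} \<subseteq> SU2"
    by (simp add: AB)
  have "generates_nonabelian {A, B, quat 0 1 0 0, quat 0 (- 1) 0 0}"
    unfolding generates_nonabelian_iff[OF SU] using assms by (auto simp: coord_dom_def u AB)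
  moreover have "A ** B ** matrix_inv A ** matrix_inv B ** quat 0 1 0 0 ** quat 0 (- 1) 0 0 = mat 1"
  proof -
    have "A ** B = B ** A" by (simp add: AB algebra_simps)
    then have "A ** B ** matrix_inv A ** matrix_inv B = B ** (A ** matrix_inv A) ** matrix_inv B"
      by (simp add: matrix_mul_assoc)
    also have "\<dots> = mat 1" using SU by (simp add: SU2_inv)
    finally show ?thesis by (simp add: mat_1_eq_quat)
  qed
  ultimately have "conj_class (A, B, quat 0 1 0 0, quat 0 (- 1) 0 0) \<in> R_star_T22"
    unfolding R_star_T22_def using SU by fastforce
  moreover have "torus_rep u = (A, B, quat 0 1 0 0, quat 0 (- 1) 0 0)"
    by (simp add: u torus_rep_eq AB)
  ultimately have "conj_class (torus_rep u) \<in> R_star_T22"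
    by simp
  then show ?thesis
    unfolding R2_star_T22_def using assms by blast
qed

lemma R_star_S24_eq: "R_star_S24 = (\<lambda>u. conj_class (pillow_rep u)) ` coord_dom"
proof
  show "R_star_S24 \<subseteq> (\<lambda>u. conj_class (pillow_rep u)) ` coord_dom"
  proof
    fix m assume "m \<in> R_star_S24"
    then obtain a b c d where m: "m = conj_class (a, b, c, d)" and SU: "{a, b, c, d} \<subseteq> SU2"
      and "b ** a = c ** d" "trace a = 0" "trace b = 0" "trace c = 0" "trace d = 0"
      and gen: "generates_nonabelian {a, b, c, d}"
      unfolding R_star_S24_def by blast
    then obtain h u where h: "h \<in> SU2" and eq: "(a, b, c, d) = conj_act h (pillow_rep u)"
      using pillow_normal_form by metis
    obtain \<gamma> \<theta> where u: "u = (\<gamma>, \<theta>)" by (cases u)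
    have "u \<in> coord_dom"
    proof (rule ccontr)
      assume "u \<notin> coord_dom"
      \<comment> \<open>With both sines zero, all four entries of the representative are real
        multiples of i, so they commute.\<close>
      then have "sin \<gamma> = 0" "sin \<theta> = 0" by (auto simp: coord_dom_def u)
      then have "x ** y = y ** x" if "x \<in> {a, b, c, d}" "y \<in> {a, b, c, d}" for x y
        using that eq by (auto simp: u pillow_rep_eq conj_act_eq commute_mconj_iff[OF h] algebra_simps)
      then show False using gen generates_nonabelian_iff[OF SU] by blast
    qed
    then show "m \<in> (\<lambda>u. conj_class (pillow_rep u)) ` coord_dom"
      using h by (simp add: m eq conj_class_conj_act)
  qed
qed (auto intro: pillow_class)

lemma R2_star_T22_eq: "R2_star_T22 = (\<lambda>u. conj_class (torus_rep u)) ` coord_dom"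
  using torus_class by (auto simp: R2_star_T22_def)

lemma mem_Union_R_star_S24:
  "x \<in> \<Union>R_star_S24 \<longleftrightarrow> (\<exists>h\<in>SU2. \<exists>u\<in>coord_dom. x = conj_act h (pillow_rep u))"
  by (auto simp: R_star_S24_eq conj_class_def)

lemma mem_Union_R2_star_T22:
  "x \<in> \<Union>R2_star_T22 \<longleftrightarrow> (\<exists>h\<in>SU2. \<exists>u\<in>coord_dom. x = conj_act h (torus_rep u))"
  by (auto simp: R2_star_T22_eq conj_class_def)

lemma pillow_to_torus_mem: "x \<in> \<Union>R_star_S24 \<Longrightarrow> pillow_to_torus x \<in> \<Union>R2_star_T22"
  unfolding mem_Union_R_star_S24 mem_Union_R2_star_T22
  by (metis pillow_to_torus_conj_act pillow_to_torus_rep)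

lemma torus_to_pillow_mem: "x \<in> \<Union>R2_star_T22 \<Longrightarrow> torus_to_pillow x \<in> \<Union>R_star_S24"
  unfolding mem_Union_R_star_S24 mem_Union_R2_star_T22
  by (metis torus_to_pillow_conj_act torus_to_pillow_rep)


section \<open>The diffeomorphism\<close>

text \<open>Taking the image of the class as a set involves no choice of coordinates, so the
  identifications between coordinates need no separate check; equivariance makes the image a full
  conjugacy class.\<close>

definition pillow_torus_map :: "quad set \<Rightarrow> quad set" where
  "pillow_torus_map m = pillow_to_torus ` m"

lemma pillow_torus_map_conj_class:
  "pillow_torus_map (conj_class x) = conj_class (pillow_to_torus x)"
  by (force simp: pillow_torus_map_def conj_class_def image_image pillow_to_torus_conj_act)

text \<open>The two polynomial maps are not mutually inverse on arbitrary quadruples: cancelling a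
  twice uses a^2 = -1. They are inverse on the standard representatives, and equivariance extends
  this to classes.\<close>

lemma bij_betw_pillow_torus_map: "bij_betw pillow_torus_map R_star_S24 R2_star_T22"
proof (rule bij_betw_byWitness[where f' = "\<lambda>m. torus_to_pillow ` m"])
  have *: "torus_to_pillow ` conj_class x = conj_class (torus_to_pillow x)" for x
    by (force simp: conj_class_def image_image torus_to_pillow_conj_act)
  show "\<forall>m\<in>R_star_S24. torus_to_pillow ` pillow_torus_map m = m"
    "\<forall>m\<in>R2_star_T22. pillow_torus_map (torus_to_pillow ` m) = m"
    "pillow_torus_map ` R_star_S24 \<subseteq> R2_star_T22" "(`) torus_to_pillow ` R2_star_T22 \<subseteq> R_star_S24"
    by (auto simp: R_star_S24_eq R2_star_T22_eq pillow_torus_map_conj_class * pillow_to_torus_rep torus_to_pillow_rep)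
qed

text \<open>Both lifts are polynomial on the whole ambient space, so a single neighbourhood,
  \<open>UNIV\<close>, serves for all points and no local section has to be chosen.\<close>

lemma is_diffeomorphism_pillow_torus_map:
  "is_diffeomorphism R_star_S24 R2_star_T22 pillow_torus_map"
proof -
  let ?G = "inv_into R_star_S24 pillow_torus_map"
  have lift: "local_smooth_lift R_star_S24 R2_star_T22 pillow_torus_map UNIV pillow_to_torus"
    using smooth_on_pillow_to_torus[OF _ smooth_on_id, of UNIV]
    by (auto simp: local_smooth_lift_def pillow_torus_map_conj_class simp del: Union_iff intro: pillow_to_torus_mem)
  have "conj_class (torus_to_pillow x) = ?G (conj_class x)" if "x \<in> \<Union>R2_star_T22" for x
  proof -
    obtain h u where h: "h \<in> SU2" and u: "u \<in> coord_dom" and x: "x = conj_act h (torus_rep u)"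
      using \<open>x \<in> \<Union>R2_star_T22\<close> unfolding mem_Union_R2_star_T22 by blast
    have "?G (pillow_torus_map (conj_class (pillow_rep u))) = conj_class (pillow_rep u)"
      using bij_betw_pillow_torus_map u pillow_class by (intro inv_into_f_f) (auto simp: bij_betw_def)
    then show ?thesis
      using h by (simp add: x conj_class_conj_act torus_to_pillow_conj_act torus_to_pillow_rep
          pillow_torus_map_conj_class pillow_to_torus_rep)
  qed
  then have lift': "local_smooth_lift R2_star_T22 R_star_S24 ?G UNIV torus_to_pillow"
    using smooth_on_torus_to_pillow[OF _ smooth_on_id, of UNIV]
    by (auto simp: local_smooth_lift_def simp del: Union_iff intro: torus_to_pillow_mem)
  have "bij_betw ?G R2_star_T22 R_star_S24"
    by (rule bij_betw_inv_into[OF bij_betw_pillow_torus_map])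
  then show ?thesis
    using lift lift' bij_betw_pillow_torus_map
    unfolding is_diffeomorphism_def smooth_map_def by (auto simp del: Union_iff dest: bij_betw_imp_surj_on)
qed


section \<open>Tangent vectors\<close>

definition torus_rep_deriv :: "real \<times> real \<Rightarrow> real \<times> real \<Rightarrow> quad" where
  "torus_rep_deriv = (\<lambda>(\<alpha>, \<beta>) (s, t).
     (quat (- s * sin \<alpha>) 0 0 (s * cos \<alpha>), quat (- t * sin \<beta>) 0 0 (t * cos \<beta>), 0, 0))"

text \<open>The fourth entry of \<open>pillow_rep\<close> is the unit vector at angle \<theta> -
  \<gamma> in the plane of i and j, hence the angular speed t - s.\<close>

definition pillow_rep_deriv :: "real \<times> real \<Rightarrow> real \<times> real \<Rightarrow> quad" where
  "pillow_rep_deriv = (\<lambda>(\<gamma>, \<theta>) (s, t).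
     (0, quat 0 (- s * sin \<gamma>) (s * cos \<gamma>) 0, quat 0 (- t * sin \<theta>) (t * cos \<theta>) 0,
      quat 0 (- (t - s) * sin (\<theta> - \<gamma>)) ((t - s) * cos (\<theta> - \<gamma>)) 0))"

lemma has_derivative_quat:
  assumes "(w has_derivative w') F" "(x has_derivative x') F" "(y has_derivative y') F" "(z has_derivative z') F"
  shows "((\<lambda>p. quat (w p) (x p) (y p) (z p)) has_derivative (\<lambda>v. quat (w' v) (x' v) (y' v) (z' v))) F"
  unfolding quat_def by (intro has_derivative_add has_derivative_scaleR_left assms)

lemma frechet_derivative_pillow_rep: "frechet_derivative pillow_rep (at u) = pillow_rep_deriv u"
proof -
  have f: "pillow_rep = (\<lambda>u. (quat 0 1 0 0, quat 0 (cos (fst u)) (sin (fst u)) 0, quat 0 (cos (snd u)) (sin (snd u)) 0,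
      quat 0 (cos (snd u - fst u)) (sin (snd u - fst u)) 0))"
    by (auto simp: pillow_rep_eq cos_diff sin_diff)
  have f': "pillow_rep_deriv u = (\<lambda>v. (quat 0 0 0 0, quat 0 (- fst v * sin (fst u)) (fst v * cos (fst u)) 0,
      quat 0 (- snd v * sin (snd u)) (snd v * cos (snd u)) 0,
      quat 0 (- (snd v - fst v) * sin (snd u - fst u)) ((snd v - fst v) * cos (snd u - fst u)) 0))"
    by (auto simp: pillow_rep_deriv_def zero_eq_quat split: prod.split)
  have "(pillow_rep has_derivative pillow_rep_deriv u) (at u)"
    unfolding f' by (subst f) (intro has_derivative_Pair has_derivative_quat; auto intro!: derivative_eq_intros simp: fun_eq_iff algebra_simps)
  then show ?thesis using frechet_derivative_at by metis
qed

text \<open>In the two coordinate systems the map is the identity, so the components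
  \<open>s\<close> of a tangent vector are unchanged; this is what makes the two forms directly
  comparable.\<close>

lemma pillow_to_torus_rep_deriv:
  "pillow_to_torus_deriv (pillow_rep u) (pillow_rep_deriv u s) = torus_rep_deriv u s"
  by (cases u; cases s)
     (simp add: pillow_to_torus_deriv_def pillow_rep_eq pillow_rep_deriv_def torus_rep_deriv_def zero_eq_quat)

section \<open>Linearising the relations along a curve\<close>

lemma has_vector_derivative_const_nhds:
  fixes f :: "real \<Rightarrow> 'a::real_normed_vector"
  assumes "(f has_vector_derivative f') (at 0)" "\<forall>\<^sub>F t in nhds 0. f t = k"
  shows "f' = 0"
proof -
  obtain S where "open S" "0 \<in> S" "\<And>t. t \<in> S \<Longrightarrow> f t = k"
    using assms(2) unfolding eventually_nhds by blast
  then have "((\<lambda>_. k) has_vector_derivative f') (at 0)"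
    by (rule has_vector_derivative_transform_within_open[OF assms(1)])
  then show ?thesis using vector_derivative_unique_at[OF _ has_vector_derivative_const] by blast
qed

lemma linear_ctranspose: "bounded_linear ctranspose"
  by (rule linear_conv_bounded_linear[THEN iffD1])
     (auto simp: linear_iff ctranspose_def vec_eq_iff)

lemma linear_trace: "bounded_linear (trace :: mat2 \<Rightarrow> complex)"
  by (rule linear_conv_bounded_linear[THEN iffD1])
     (auto simp: linear_iff trace_def sum_2 algebra_simps)

lemma su2_has_vector_derivative:
  assumes f: "(f has_vector_derivative f') (at 0)" and su: "\<forall>\<^sub>F t in nhds 0. f t \<in> su2"
  shows "f' \<in> su2"
proof -
  have "((\<lambda>t. ctranspose (f t) + f t) has_vector_derivative ctranspose f' + f') (at 0)"
    by (intro has_vector_derivative_add f bounded_linear.has_vector_derivative[OF linear_ctranspose])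
  then have "ctranspose f' + f' = 0"
    by (rule has_vector_derivative_const_nhds) (use su in eventually_elim, simp add: su2_def)
  moreover have "((\<lambda>t. trace (f t)) has_vector_derivative trace f') (at 0)"
    by (intro f bounded_linear.has_vector_derivative[OF linear_trace])
  then have "trace f' = 0"
    by (rule has_vector_derivative_const_nhds) (use su in eventually_elim, simp add: su2_def)
  ultimately show ?thesis by (simp add: su2_def eq_neg_iff_add_eq_0)
qed

lemma smooth_curve_in_derivative:
  assumes "smooth_curve_in X c"
  shows "(c has_vector_derivative vector_derivative c (at 0)) (at 0)" "\<forall>\<^sub>F t in nhds 0. c t \<in> X"
proof -
  obtain \<epsilon> where \<epsilon>: "\<epsilon> > 0" "smooth_on {- \<epsilon> <..< \<epsilon>} c" "c ` {- \<epsilon> <..< \<epsilon>} \<subseteq> X"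
    using assms by (auto simp: smooth_curve_in_def)
  have "c differentiable (at 0)" using smooth_on_differentiable[OF \<epsilon>(2)] \<epsilon>(1) by simp
  then show "(c has_vector_derivative vector_derivative c (at 0)) (at 0)" by (simp add: vector_derivative_works)
  have "\<forall>\<^sub>F t in nhds 0. t \<in> {- \<epsilon> <..< \<epsilon>}" using \<epsilon>(1) by (intro eventually_nhds_in_open) auto
  then show "\<forall>\<^sub>F t in nhds 0. c t \<in> X" by eventually_elim (use \<epsilon>(3) in auto)
qed

lemma quat_in_su2 [simp]: "quat w x y z \<in> su2 \<longleftrightarrow> w = 0"
  by (auto simp: mem_su2_iff)

text \<open>All these relations are invariant under conjugation, so they are verified at the
  standard representative and transported. They are the ones to be linearised: a, b, c are unit
  imaginary quaternions, d is determined by them, and the last trace condition is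
  coplanarity.\<close>

lemma pillow_relations:
  assumes "(a, b, c, d) \<in> \<Union>R_star_S24"
  shows "a \<in> su2" "b \<in> su2" "c \<in> su2" "a ** a = - mat 1" "b ** b = - mat 1" "c ** c = - mat 1"
    "d = - (c ** b ** a)" "trace (c ** b ** a) = 0"
proof -
  obtain h u where h: "h \<in> SU2" and eq: "(a, b, c, d) = conj_act h (pillow_rep u)"
    using assms mem_Union_R_star_S24 by blast
  obtain \<gamma> \<theta> where u: "u = (\<gamma>, \<theta>)" by (cases u)
  define b0 c0 where bc0: "b0 = quat 0 (cos \<gamma>) (sin \<gamma>) 0" "c0 = quat 0 (cos \<theta>) (sin \<theta>) 0"
  have abc: "a = mconj h (quat 0 1 0 0)" "b = mconj h b0" "c = mconj h c0"
    and "d = mconj h (- (c0 ** b0 ** quat 0 1 0 0))"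
    using eq by (auto simp: u pillow_rep_eq conj_act_eq bc0 algebra_simps)
  then show "d = - (c ** b ** a)" using h by (simp only: mconj_mult mconj_minus)
  show "a \<in> su2" "b \<in> su2" "c \<in> su2" unfolding abc bc0 using h by (simp_all add: mconj_su2)
  have "quat 0 x y 0 ** quat 0 x y 0 = - mat 1" if "x\<^sup>2 + y\<^sup>2 = 1" for x y
    using that by (simp add: mat_1_eq_quat power2_eq_square)
  from this[of 1 0] this[of "cos \<gamma>" "sin \<gamma>"] this[of "cos \<theta>" "sin \<theta>"]
  have "quat 0 1 0 0 ** quat 0 1 0 0 = - mat 1" "b0 ** b0 = - mat 1" "c0 ** c0 = - mat 1"
    by (simp_all add: bc0)
  moreover have "mconj h (- mat 1) = - mat 1"
    using h by (simp add: mconj_minus)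
  ultimately show "a ** a = - mat 1" "b ** b = - mat 1" "c ** c = - mat 1"
    unfolding abc mconj_mult[OF h, symmetric] by (simp_all only:)
  have "trace (c0 ** b0 ** quat 0 1 0 0) = 0" by (simp add: bc0)
  then show "trace (c ** b ** a) = 0"
    unfolding abc mconj_mult[OF h, symmetric] using h by simp
qed

text \<open>The tangent space of \<open>\<Union>R_star_S24\<close> is computed by differentiating the defining relations.\<close>

lemma pillow_derivative:
  assumes u: "u \<in> coord_dom" and C: "(C has_vector_derivative V) (at 0)"
    and C0: "C 0 = pillow_rep u" and mem: "\<forall>\<^sub>F t in nhds 0. C t \<in> \<Union>R_star_S24"
  shows "\<exists>s. \<exists>\<xi>\<in>su2. V = pillow_rep_deriv u s + inf_conj \<xi> (pillow_rep u)"
proof -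
  obtain \<gamma> \<theta> where ueq: "u = (\<gamma>, \<theta>)" by (cases u)
  obtain a' b' c' d' where V: "V = (a', b', c', d')" by (cases V)
  define a b c d where abcd: "a = (\<lambda>t. fst (C t))" "b = (\<lambda>t. fst (snd (C t)))" "c = (\<lambda>t. fst (snd (snd (C t))))"
    "d = (\<lambda>t. snd (snd (snd (C t))))"
  have D: "(a has_vector_derivative a') (at 0)" "(b has_vector_derivative b') (at 0)"
    "(c has_vector_derivative c') (at 0)" "(d has_vector_derivative d') (at 0)"
    unfolding abcd
    using C
      bounded_linear.has_vector_derivative[OF bounded_linear_fst C]
      bounded_linear.has_vector_derivative[OF bounded_linear_snd C]
      bounded_linear.has_vector_derivative[OF bounded_linear_fst
        bounded_linear.has_vector_derivative[OF bounded_linear_snd C]]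
      bounded_linear.has_vector_derivative[OF bounded_linear_fst
        bounded_linear.has_vector_derivative[OF bounded_linear_snd
        bounded_linear.has_vector_derivative[OF bounded_linear_snd C]]]
      bounded_linear.has_vector_derivative[OF bounded_linear_snd
        bounded_linear.has_vector_derivative[OF bounded_linear_snd
        bounded_linear.has_vector_derivative[OF bounded_linear_snd C]]]
    by (simp_all add: V)
  let ?a = "quat 0 1 0 0" and ?b = "quat 0 (cos \<gamma>) (sin \<gamma>) 0" and ?c = "quat 0 (cos \<theta>) (sin \<theta>) 0"
  have at0: "a 0 = ?a" "b 0 = ?b" "c 0 = ?c"
    by (simp_all add: abcd C0 ueq pillow_rep_eq)
  have ev: "\<forall>\<^sub>F t in nhds 0. (a t, b t, c t, d t) \<in> \<Union>R_star_S24"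
    using mem by (simp add: abcd)
  have sq: "f' ** f 0 + f 0 ** f' = 0"
    if "(f has_vector_derivative f') (at 0)" "\<forall>\<^sub>F t in nhds 0. f t ** f t = - mat 1" for f :: "real \<Rightarrow> mat2" and f'
    using has_vector_derivative_const_nhds[OF mmul.has_vector_derivative[OF that(1) that(1)] that(2)]
    by (simp add: add.commute)
  have "a' \<in> su2" "b' \<in> su2" "c' \<in> su2"
    using su2_has_vector_derivative[OF D(1) eventually_mono[OF ev pillow_relations(1)]]
      su2_has_vector_derivative[OF D(2) eventually_mono[OF ev pillow_relations(2)]]
      su2_has_vector_derivative[OF D(3) eventually_mono[OF ev pillow_relations(3)]]
    by simp_all
  then obtain a1 a2 a3 b1 b2 b3 c1 c2 c3 where
    q: "a' = quat 0 a1 a2 a3" "b' = quat 0 b1 b2 b3" "c' = quat 0 c1 c2 c3"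
    unfolding mem_su2_iff by blast
  have "a' ** ?a + ?a ** a' = 0" "b' ** ?b + ?b ** b' = 0" "c' ** ?c + ?c ** c' = 0"
    using sq[OF D(1) eventually_mono[OF ev pillow_relations(4)]]
      sq[OF D(2) eventually_mono[OF ev pillow_relations(5)]]
      sq[OF D(3) eventually_mono[OF ev pillow_relations(6)]]
    by (simp_all only: at0)
  \<comment> \<open>For imaginary quaternions anticommuting means being orthogonal, so each
    derivative is tangent to the unit sphere.\<close>
  then have orth: "a1 = 0" "b1 * cos \<gamma> + b2 * sin \<gamma> = 0" "c1 * cos \<theta> + c2 * sin \<theta> = 0"
    by (auto simp: q zero_eq_quat)
  let ?T = "c' ** ?b ** ?a + ?c ** b' ** ?a + ?c ** ?b ** a'"
  have T: "((\<lambda>t. c t ** b t ** a t) has_vector_derivative ?T) (at 0)"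
    using mmul.has_vector_derivative[OF mmul.has_vector_derivative[OF D(3) D(2)] D(1)]
    by (simp add: at0 mmul.add_left mmul.add_right add_ac)
  have "((\<lambda>t. trace (c t ** b t ** a t)) has_vector_derivative trace ?T) (at 0)"
    by (intro bounded_linear.has_vector_derivative[OF linear_trace] T)
  then have "trace ?T = 0"
    by (rule has_vector_derivative_const_nhds[OF _ eventually_mono[OF ev pillow_relations(8)]])
  \<comment> \<open>Linearised coplanarity: the out-of-plane speeds of b and c, corrected for the
    motion of a, are proportional to sin \<gamma> and sin \<theta>, so one rotation about i can
    account for both.\<close>
  then have tr: "(b3 - a3 * cos \<gamma>) * sin \<theta> = (c3 - a3 * cos \<theta>) * sin \<gamma>"
    by (simp add: q orth(1) complex_eq_iff algebra_simps)
  have "((\<lambda>t. d t + c t ** b t ** a t) has_vector_derivative d' + ?T) (at 0)"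
    by (intro has_vector_derivative_add D T)
  then have "d' + ?T = 0"
    by (rule has_vector_derivative_const_nhds[where k = 0, OF _ eventually_mono[OF ev]])
       (drule pillow_relations(7), simp)
  then have d': "d' = - ?T" by (rule iffD2[OF eq_neg_iff_add_eq_0])
  \<comment> \<open>Angular speeds of b and c within the plane of i and j, measured relative to the
    angular speed \<open>a2\<close> of a.\<close>
  define s t where st: "s = b2 * cos \<gamma> - b1 * sin \<gamma> - a2" "t = c2 * cos \<theta> - c1 * sin \<theta> - a2"
  define n where "n = (sin \<gamma>)\<^sup>2 + (sin \<theta>)\<^sup>2"
  have n0: "n \<noteq> 0" using u by (auto simp: n_def ueq coord_dom_def sum_power2_eq_zero_iff)
  \<comment> \<open>Least squares solution of the two equations for the rotation speed about i. It
    solves both exactly because of \<open>tr\<close>, and the denominator is nonzero on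
    \<open>coord_dom\<close>.\<close>
  define \<mu> where "\<mu> = ((b3 - a3 * cos \<gamma>) * sin \<gamma> + (c3 - a3 * cos \<theta>) * sin \<theta>) / (2 * n)"
  have mu: "2 * n * \<mu> = (b3 - a3 * cos \<gamma>) * sin \<gamma> + (c3 - a3 * cos \<theta>) * sin \<theta>"
    using n0 by (simp add: \<mu>_def)
  have "n * (2 * \<mu> * sin \<gamma>) = n * (b3 - a3 * cos \<gamma>)" "n * (2 * \<mu> * sin \<theta>) = n * (c3 - a3 * cos \<theta>)"
    using mu tr unfolding n_def by algebra+
  then have mu': "2 * \<mu> * sin \<gamma> = b3 - a3 * cos \<gamma>" "2 * \<mu> * sin \<theta> = c3 - a3 * cos \<theta>"
    using n0 by simp_all
  \<comment> \<open>The commutator of imaginary quaternions is twice their cross product, hence the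
    halves. The j and k coefficients reproduce \<open>a'\<close>; the i coefficient fixes a and
    supplies the remaining out-of-plane motion of b and c.\<close>
  define \<xi> where "\<xi> = quat 0 \<mu> (- a3 / 2) (a2 / 2)"
  let ?Db = "quat 0 (- s * sin \<gamma>) (s * cos \<gamma>) 0" and ?Dc = "quat 0 (- t * sin \<theta>) (t * cos \<theta>) 0"
  have ea: "a' = \<xi> ** ?a - ?a ** \<xi>"
    by (simp add: q \<xi>_def orth(1))
  have "b1 = - ((b2 * cos \<gamma> - b1 * sin \<gamma>) * sin \<gamma>)" "b2 = (b2 * cos \<gamma> - b1 * sin \<gamma>) * cos \<gamma>"
    using orth(2) sin_cos_squared_add[of \<gamma>] by algebra+
  then have eb: "b' = ?Db + (\<xi> ** ?b - ?b ** \<xi>)"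
    using mu' by (simp add: q \<xi>_def st algebra_simps)
  have "c1 = - ((c2 * cos \<theta> - c1 * sin \<theta>) * sin \<theta>)" "c2 = (c2 * cos \<theta> - c1 * sin \<theta>) * cos \<theta>"
    using orth(3) sin_cos_squared_add[of \<theta>] by algebra+
  then have ec: "c' = ?Dc + (\<xi> ** ?c - ?c ** \<xi>)"
    using mu' by (simp add: q \<xi>_def st algebra_simps)
  \<comment> \<open>Since the commutator with \<xi> is a derivation, the orbit parts of the three
    factors add up to the orbit part of their product; thus the \<xi> found from a, b, c also fits
    d.\<close>
  have leibniz: "(y + (\<xi> ** c - c ** \<xi>)) ** b ** a + c ** (x + (\<xi> ** b - b ** \<xi>)) ** a + c ** b ** (\<xi> ** a - a ** \<xi>) =
      (y ** b ** a + c ** x ** a) + (\<xi> ** (c ** b ** a) - (c ** b ** a) ** \<xi>)" for a b c x y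
    by (simp add: mmul.add_left mmul.add_right mmul.diff_left mmul.diff_right matrix_mul_assoc)
  let ?d = "- (?c ** ?b ** ?a)"
  have "d' = - (?Dc ** ?b ** ?a + ?c ** ?Db ** ?a) + (\<xi> ** ?d - ?d ** \<xi>)"
    unfolding d' by (subst ea, subst eb, subst ec)
      (simp only: leibniz mmul.minus_left mmul.minus_right minus_add_distrib minus_diff_eq diff_minus_eq_add, simp only: ac_simps diff_conv_add_uminus minus_minus)
  moreover have "- (?Dc ** ?b ** ?a + ?c ** ?Db ** ?a) =
      quat 0 (- (t - s) * sin (\<theta> - \<gamma>)) ((t - s) * cos (\<theta> - \<gamma>)) 0"
    by (simp add: sin_diff cos_diff algebra_simps)
  moreover have "?d = quat 0 (cos \<theta> * cos \<gamma> + sin \<theta> * sin \<gamma>) (sin \<theta> * cos \<gamma> - cos \<theta> * sin \<gamma>) 0"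
    by (simp add: algebra_simps)
  ultimately have ed: "d' = quat 0 (- (t - s) * sin (\<theta> - \<gamma>)) ((t - s) * cos (\<theta> - \<gamma>)) 0 +
      (\<xi> ** quat 0 (cos \<theta> * cos \<gamma> + sin \<theta> * sin \<gamma>) (sin \<theta> * cos \<gamma> - cos \<theta> * sin \<gamma>) 0
       - quat 0 (cos \<theta> * cos \<gamma> + sin \<theta> * sin \<gamma>) (sin \<theta> * cos \<gamma> - cos \<theta> * sin \<gamma>) 0 ** \<xi>)"
    by (simp only:)
  have "V = pillow_rep_deriv u (s, t) + inf_conj \<xi> (pillow_rep u)"
    unfolding V ueq pillow_rep_deriv_def pillow_rep_eq inf_conj_def
    by (simp only: prod.case add_Pair add_0 prod.inject ea eb ec ed)
  moreover have "\<xi> \<in> su2" by (simp add: \<xi>_def)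
  ultimately show ?thesis by blast
qed

text \<open>A curve through the class may start at any conjugate of the standard representative.
  Moving its start there by the inverse conjugation makes the linearised relations applicable, and
  the tangent class absorbs both the conjugation and the orbit direction.\<close>

lemma tangent_space_pillow:
  assumes u: "u \<in> coord_dom" and p: "p \<in> tangent_space R_star_S24 (conj_class (pillow_rep u))"
  obtains s where "p = tangent_class (pillow_rep u) (pillow_rep_deriv u s)"
proof -
  obtain c where c: "smooth_curve_in (\<Union>R_star_S24) c" and "c 0 \<in> conj_class (pillow_rep u)" and p: "p = velocity c"
    using p by (auto simp: tangent_space_def)
  then obtain g where g: "g \<in> SU2" and c0: "c 0 = conj_act g (pillow_rep u)"
    by (auto simp: conj_class_def)
  let ?v = "vector_derivative c (at 0)"
  have D: "((\<lambda>t. conj_act (matrix_inv g) (c t)) has_vector_derivative conj_act (matrix_inv g) ?v) (at 0)"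
    by (intro bounded_linear.has_vector_derivative[OF bounded_linear_conj_act] smooth_curve_in_derivative[OF c])
  have "conj_act (matrix_inv g) x \<in> \<Union>R_star_S24" if "x \<in> \<Union>R_star_S24" for x
    using that g unfolding mem_Union_R_star_S24 by (metis SU2_inv(1) SU2_mult conj_act_conj_act)
  then have M: "\<forall>\<^sub>F t in nhds 0. conj_act (matrix_inv g) (c t) \<in> \<Union>R_star_S24"
    using smooth_curve_in_derivative(2)[OF c] by (rule eventually_mono[rotated])
  have "conj_act (matrix_inv g) (c 0) = pillow_rep u"
    using g by (simp add: c0)
  from pillow_derivative[OF u D this M] obtain s \<xi> where \<xi>: "\<xi> \<in> su2"
    and V: "conj_act (matrix_inv g) ?v = pillow_rep_deriv u s + inf_conj \<xi> (pillow_rep u)"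
    by blast
  have "?v = conj_act g (pillow_rep_deriv u s) + inf_conj (mconj g \<xi>) (conj_act g (pillow_rep u))"
    using arg_cong[OF V, of "conj_act g"] g by (simp add: conj_act_add conj_act_inf_conj)
  then have "p = tangent_class (pillow_rep u) (pillow_rep_deriv u s)"
    unfolding p velocity_def c0 using tangent_class_conj_act[OF g mconj_su2[OF g \<xi>]] by simp
  then show ?thesis by (rule that)
qed


section \<open>Curves with the same image in the quotient\<close>

text \<open>At \<^term>\<open>torus_rep (\<alpha>, \<beta>)\<close> this is \<open>2 (p sin \<alpha> + q sin \<beta>) k\<close>.\<close>

definition normal_vec :: "real \<Rightarrow> real \<Rightarrow> quad \<Rightarrow> mat2" where
  "normal_vec p q = (\<lambda>(A, B, a, b). p *\<^sub>R (A + a ** A ** a) + q *\<^sub>R (B + a ** B ** a))"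

text \<open>
  If \<open>x\<close> and \<open>y\<close> are conjugate then \<open>X = intertwiner p q g y x\<close> satisfies \<open>y X = X x\<close>
  componentwise: averaging \<open>g\<close> over the group generated by \<open>i\<close> and \<open>k\<close> projects it onto the
  line of intertwiners. Unlike a conjugating element, \<open>X\<close> is a polynomial in \<open>x\<close> and \<open>y\<close>.
\<close>

definition intertwiner :: "real \<Rightarrow> real \<Rightarrow> mat2 \<Rightarrow> quad \<Rightarrow> quad \<Rightarrow> mat2" where
  "intertwiner p q g y x =
     (let n = normal_vec p q y; Y = g + - (fst (snd (snd y)) ** g ** fst (snd (snd x)))
      in n ** n ** Y + n ** Y ** normal_vec p q x)"

lemma normal_vec_conj_act:
  "g \<in> SU2 \<Longrightarrow> normal_vec p q (conj_act g x) = mconj g (normal_vec p q x)"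
  by (cases x)
     (simp add: normal_vec_def conj_act_eq mconj_add mconj_mult
        linear_cmul[OF bounded_linear.linear[OF bounded_linear_mconj]])

lemma mconj_mult_cancel:
  assumes "k \<in> SU2"
  shows "mconj k m ** (k ** X) = k ** (m ** X)" "(X ** matrix_inv k) ** mconj k m = X ** m ** matrix_inv k"
  by (metis (no_types) mconj_def matrix_mul_assoc matrix_mul_rid SU2_inv(3)[OF assms])
     (metis (no_types) mconj_def matrix_mul_assoc matrix_mul_rid SU2_inv(3)[OF assms])

text \<open>Both quadruples may be conjugated independently, which reduces the evaluation for
  conjugate quadruples to the case where both equal one standard representative.\<close>

lemma intertwiner_conj_act:
  assumes k: "k \<in> SU2" and h: "h \<in> SU2"
  shows "intertwiner p q (k ** g ** matrix_inv h) (conj_act k y) (conj_act h x) =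
    k ** intertwiner p q g y x ** matrix_inv h"
proof -
  obtain A B a b where x: "x = (A, B, a, b)" by (cases x)
  obtain A' B' a' b' where y: "y = (A', B', a', b')" by (cases y)
  have left: "mconj k m ** (k ** X ** matrix_inv h) = k ** (m ** X) ** matrix_inv h" for m X
    using mconj_mult_cancel(1)[OF k] by (metis matrix_mul_assoc)
  have right: "(k ** X ** matrix_inv h) ** mconj h m = k ** (X ** m) ** matrix_inv h" for m X
    using mconj_mult_cancel(2)[OF h, of "k ** X"] by (metis matrix_mul_assoc)
  have sum: "k ** X ** matrix_inv h + k ** Y ** matrix_inv h = k ** (X + Y) ** matrix_inv h"
    "- (k ** X ** matrix_inv h) = k ** (- X) ** matrix_inv h" for X Y
    by (simp_all add: mmul.add_left mmul.add_right mmul.minus_left mmul.minus_right)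
  have "fst (snd (snd (conj_act k y))) = mconj k a'" "fst (snd (snd (conj_act h x))) = mconj h a"
    by (simp_all add: x y conj_act_eq)
  then show ?thesis
    unfolding intertwiner_def Let_def normal_vec_conj_act[OF k] normal_vec_conj_act[OF h]
    by (simp only: mconj_mult[OF k, symmetric] left right sum) (simp add: x y)
qed

text \<open>With \<sigma> = p sin \<alpha> + q sin \<beta> and n = 2 \<sigma> k, the combination g -
  i g i doubles the coefficients of 1 and i and drops the others. Adding the k-average then cancels
  i and doubles the real part, while n^2 contributes -4 \<sigma>^2; together this is -16 \<sigma>^2
  w.\<close>

lemma intertwiner_torus_rep:
  "intertwiner p q (quat w x y z) (torus_rep (\<alpha>, \<beta>)) (torus_rep (\<alpha>, \<beta>)) =
    (- 16 * (p * sin \<alpha> + q * sin \<beta>)\<^sup>2 * w) *\<^sub>R mat 1"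
  by (simp add: intertwiner_def normal_vec_def torus_rep_eq mat_1_eq_quat Let_def power2_eq_square algebra_simps)

lemma smooth_on_normal_vec:
  assumes "open S" "smooth_on S f"
  shows "smooth_on S (\<lambda>t. normal_vec p q (f t))"
  unfolding normal_vec_def split_beta
  by (intro smooth_on_add smooth_on_bilinear[OF _ bounded_bilinear_matrix_mult]
      smooth_on_linear[OF _ bounded_linear_fst] smooth_on_linear[OF _ bounded_linear_snd]
      smooth_on_linear[OF _ bounded_linear_scaleR_right] assms)

lemma smooth_on_intertwiner:
  assumes "open S" "smooth_on S f" "smooth_on S g"
  shows "smooth_on S (\<lambda>t. intertwiner p q m (f t) (g t))"
  unfolding intertwiner_def Let_def
  by (intro smooth_on_add smooth_on_bilinear[OF _ bounded_bilinear_matrix_mult] smooth_on_normal_vec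
      smooth_on_linear[OF _ bounded_linear_minus[OF bounded_linear_ident]] smooth_on_const
      smooth_on_linear[OF _ bounded_linear_fst] smooth_on_linear[OF _ bounded_linear_snd] assms)

text \<open>The quaternions form a real linear subspace of the complex matrices, cut out by
  \<open>L\<close>. It is needed to split the derivative of an intertwiner into a real scalar and an
  element of su(2).\<close>

lemma quat_has_vector_derivative:
  assumes f: "(f has_vector_derivative f') (at 0)" and ev: "\<forall>\<^sub>F t in nhds 0. \<exists>w x y z. f t = quat w x y z"
  shows "\<exists>w x y z. f' = quat w x y z"
proof -
  define L :: "mat2 \<Rightarrow> complex \<times> complex" where
    "L m = (ctranspose m $ 1 $ 1 - m $ 2 $ 2, ctranspose m $ 1 $ 2 + m $ 1 $ 2)" for m
  have L: "bounded_linear L"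
    by (rule linear_conv_bounded_linear[THEN iffD1]) (auto simp: linear_iff L_def ctranspose_def algebra_simps)
  have "L f' = 0"
    using bounded_linear.has_vector_derivative[OF L f]
  proof (rule has_vector_derivative_const_nhds)
    show "\<forall>\<^sub>F t in nhds 0. L (f t) = 0"
      using ev by eventually_elim (auto simp: L_def quat_entries complex_eq_iff zero_prod_def)
  qed
  then have "cnj (f' $ 1 $ 1) = f' $ 2 $ 2" "cnj (f' $ 2 $ 1) = - f' $ 1 $ 2"
    by (auto simp: L_def ctranspose_def zero_prod_def eq_neg_iff_add_eq_0)
  then have "f' = quat (Re (f'$1$1)) (Im (f'$1$1)) (Re (f'$1$2)) (Im (f'$1$2))"
    by (auto simp: vec_eq_iff forall_2 quat_entries complex_eq_iff)
  then show ?thesis by blast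
qed

text \<open>Differentiate d G = G e and divide by G(0) = \<kappa> g. The term with G' becomes a
  commutator with G' g^(-1) / \<kappa>, so the derivatives of d and e differ by conjugation with g
  and an orbit direction.\<close>

lemma derivative_of_intertwined:
  assumes d: "(d has_vector_derivative d') (at 0)" and e: "(e has_vector_derivative e') (at 0)"
    and G: "(G has_vector_derivative G') (at 0)" and ev: "\<forall>\<^sub>F t in nhds 0. d t ** G t = G t ** e t"
    and g: "g \<in> SU2" and G0: "G 0 = \<kappa> *\<^sub>R g" and \<kappa>: "\<kappa> \<noteq> 0"
    and \<xi>: "\<xi> + r *\<^sub>R mat 1 = (1 / \<kappa>) *\<^sub>R (G' ** matrix_inv g)"
  shows "d' = mconj g e' + (\<xi> ** mconj g (e 0) - mconj g (e 0) ** \<xi>)"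
proof -
  let ?\<xi> = "(1 / \<kappa>) *\<^sub>R (G' ** matrix_inv g)"
  have e0: "d 0 ** G 0 = G 0 ** e 0" using ev by (rule eventually_nhds_x_imp_x)
  have d0: "d 0 = mconj g (e 0)"
    using e0 \<kappa> g by (intro mconj_eqI[symmetric]) (simp_all add: G0 mmul.scaleR_left mmul.scaleR_right)
  have G'eq: "(1 / \<kappa>) *\<^sub>R G' = ?\<xi> ** g"
    using g by (simp add: mmul.scaleR_left SU2_inv flip: matrix_mul_assoc)
  have "((\<lambda>t. d t ** G t + - (G t ** e t)) has_vector_derivative (d 0 ** G' + d' ** G 0) + - (G 0 ** e' + G' ** e 0)) (at 0)"
    by (intro has_vector_derivative_add has_vector_derivative_minus mmul.has_vector_derivative d e G)
  then have "(d 0 ** G' + d' ** G 0) + - (G 0 ** e' + G' ** e 0) = 0"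
    by (rule has_vector_derivative_const_nhds[where k = 0]) (use ev in eventually_elim, simp)
  then have "d' ** G 0 = G 0 ** e' + G' ** e 0 - d 0 ** G'"
    by (simp add: algebra_simps)
  then have "(1 / \<kappa>) *\<^sub>R (d' ** G 0) = (1 / \<kappa>) *\<^sub>R (G 0 ** e' + G' ** e 0 - d 0 ** G')"
    by simp
  then have "d' ** g = g ** e' + ((1 / \<kappa>) *\<^sub>R G') ** e 0 - d 0 ** ((1 / \<kappa>) *\<^sub>R G')"
    using \<kappa> by (simp add: G0 mmul.scaleR_left mmul.scaleR_right scaleR_add_right scaleR_diff_right)
  then have "d' ** g = g ** e' + ?\<xi> ** g ** e 0 - d 0 ** ?\<xi> ** g"
    by (simp only: G'eq matrix_mul_assoc)
  then have "d' ** g ** matrix_inv g = (g ** e' + ?\<xi> ** g ** e 0 - d 0 ** ?\<xi> ** g) ** matrix_inv g"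
    by simp
  then have "d' = mconj g e' + (?\<xi> ** mconj g (e 0) - d 0 ** ?\<xi>)"
    using g by (simp add: mconj_def mmul.add_left mmul.diff_left SU2_inv flip: matrix_mul_assoc)
  \<comment> \<open>The scalar part \<open>r\<close> is central and drops out of the
    commutator.\<close>
  also have "?\<xi> ** mconj g (e 0) - d 0 ** ?\<xi> = \<xi> ** mconj g (e 0) - mconj g (e 0) ** \<xi>"
    unfolding \<xi>[symmetric] d0
    by (simp add: mmul.add_left mmul.add_right mmul.scaleR_left mmul.scaleR_right)
  finally show ?thesis .
qed

text \<open>This is the uniqueness behind \<open>tangent_map\<close>. The differentiable curve
  \<open>G\<close> of intertwiners stands in for a curve of conjugating elements; it may vanish at
  some times, but at time 0 it is a nonzero multiple of \<open>g0\<close>, and only its first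
  derivative there enters.\<close>

lemma velocity_eq_if_conj_class_eq:
  assumes d: "smooth_curve_in (\<Union>R2_star_T22) d" and e: "smooth_curve_in (\<Union>R2_star_T22) e"
    and ev: "\<forall>\<^sub>F t in nhds 0. conj_class (d t) = conj_class (e t)"
  shows "velocity d = velocity e"
proof -
  obtain \<epsilon> where \<epsilon>: "\<epsilon> > 0" "smooth_on {- \<epsilon> <..< \<epsilon>} d"
    using d by (auto simp: smooth_curve_in_def)
  obtain \<epsilon>' where \<epsilon>': "\<epsilon>' > 0" "smooth_on {- \<epsilon>' <..< \<epsilon>'} e"
    using e by (auto simp: smooth_curve_in_def)
  note D = smooth_curve_in_derivative[OF d] and E = smooth_curve_in_derivative[OF e]
  let ?d = "vector_derivative d (at 0)" and ?e = "vector_derivative e (at 0)"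
  have mem0: "e 0 \<in> \<Union>R2_star_T22" using E(2) by (rule eventually_nhds_x_imp_x)
  then obtain h0 u0 where h0: "h0 \<in> SU2" and u0: "u0 \<in> coord_dom" and e0: "e 0 = conj_act h0 (torus_rep u0)"
    unfolding mem_Union_R2_star_T22 by blast
  have "conj_class (d 0) = conj_class (e 0)" using ev by (rule eventually_nhds_x_imp_x)
  then obtain g0 where g0: "g0 \<in> SU2" and d0: "d 0 = conj_act g0 (e 0)" by (rule conj_class_eqD)
  obtain \<alpha> \<beta> where u0eq: "u0 = (\<alpha>, \<beta>)" by (cases u0)
  \<comment> \<open>With this choice p sin \<alpha> + q sin \<beta> is sin^2 \<alpha> + sin^2
    \<beta>, which is nonzero at the base point, so that \<open>G 0\<close> does not vanish.\<close>
  define p q where pq: "p = sin \<alpha>" "q = sin \<beta>"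
  define G where "G t = intertwiner p q g0 (d t) (e t)" for t
  have form: "\<exists>r k h. k \<in> SU2 \<and> h \<in> SU2 \<and> G t = r *\<^sub>R (k ** matrix_inv h) \<and>
      (\<exists>x. d t = conj_act k x \<and> e t = conj_act h x)"
    if "e t \<in> \<Union>R2_star_T22" "conj_class (d t) = conj_class (e t)" for t
  proof -
    obtain h u where h: "h \<in> SU2" and et: "e t = conj_act h (torus_rep u)"
      using \<open>e t \<in> \<Union>R2_star_T22\<close> unfolding mem_Union_R2_star_T22 by blast
    obtain g where g: "g \<in> SU2" and dt: "d t = conj_act g (e t)"
      using \<open>conj_class (d t) = conj_class (e t)\<close> by (rule conj_class_eqD)
    define k where "k = g ** h"
    have k: "k \<in> SU2" using g h by (simp add: k_def SU2_mult)
    have dk: "d t = conj_act k (torus_rep u)" using g h by (simp add: dt et k_def conj_act_conj_act)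
    \<comment> \<open>\<open>g0\<close> seen from the standard representative: \<open>k\<close> and
      \<open>h\<close> carry that representative to \<open>d t\<close> and
      \<open>e t\<close>.\<close>
    define m where "m = matrix_inv k ** g0 ** h"
    have "m \<in> SU2" using k g0 h by (simp add: m_def SU2_mult SU2_inv)
    then obtain w x y z where m: "m = quat w x y z" by (auto simp: mem_SU2_iff)
    have "k ** m ** matrix_inv h = (k ** matrix_inv k) ** g0 ** (h ** matrix_inv h)"
      by (simp add: m_def matrix_mul_assoc)
    then have "g0 = k ** m ** matrix_inv h" using k h by (simp add: SU2_inv)
    then have "G t = k ** intertwiner p q m (torus_rep u) (torus_rep u) ** matrix_inv h"
      unfolding G_def dk et using intertwiner_conj_act[OF k h] by simp
    moreover obtain r where "intertwiner p q m (torus_rep u) (torus_rep u) = r *\<^sub>R mat 1"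
      unfolding m by (metis intertwiner_torus_rep surj_pair)
    ultimately have "G t = r *\<^sub>R (k ** matrix_inv h)"
      by (simp add: mmul.scaleR_left mmul.scaleR_right)
    then show ?thesis using k h dk et by blast
  qed
  have G0: "\<exists>\<kappa>. \<kappa> \<noteq> 0 \<and> G 0 = \<kappa> *\<^sub>R g0"
  proof -
    \<comment> \<open>At time 0 the frames are \<open>g0 ** h0\<close> and \<open>h0\<close>, so the
      averaged element is 1; its real part 1 keeps \<kappa> away from zero.\<close>
    have "g0 = (g0 ** h0) ** quat 1 0 0 0 ** matrix_inv h0"
      using h0 by (simp add: SU2_inv flip: mat_1_eq_quat matrix_mul_assoc)
    moreover have "d 0 = conj_act (g0 ** h0) (torus_rep u0)"
      using g0 h0 by (simp add: d0 e0 conj_act_conj_act)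
    ultimately have "G 0 = (g0 ** h0) ** intertwiner p q (quat 1 0 0 0) (torus_rep u0) (torus_rep u0) ** matrix_inv h0"
      unfolding G_def e0 using intertwiner_conj_act[OF SU2_mult[OF g0 h0] h0] by metis
    moreover define \<kappa> where "\<kappa> = - 16 * (p * sin \<alpha> + q * sin \<beta>)\<^sup>2 * 1"
    have "intertwiner p q (quat 1 0 0 0) (torus_rep u0) (torus_rep u0) = \<kappa> *\<^sub>R mat 1"
      unfolding u0eq \<kappa>_def by (rule intertwiner_torus_rep)
    ultimately have "G 0 = \<kappa> *\<^sub>R g0"
      using h0 by (simp add: mmul.scaleR_left mmul.scaleR_right SU2_inv flip: matrix_mul_assoc)
    then show ?thesis
      using u0 by (intro exI[of _ \<kappa>])
        (auto simp: \<kappa>_def pq u0eq coord_dom_def simp flip: power2_eq_square simp: sum_power2_eq_zero_iff)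
  qed
  then obtain \<kappa> where \<kappa>: "\<kappa> \<noteq> 0" "G 0 = \<kappa> *\<^sub>R g0" by blast
  have ev2: "\<forall>\<^sub>F t in nhds 0. \<exists>r k h. k \<in> SU2 \<and> h \<in> SU2 \<and> G t = r *\<^sub>R (k ** matrix_inv h) \<and>
      (\<exists>x. d t = conj_act k x \<and> e t = conj_act h x)"
    using E(2) ev by eventually_elim (rule form)
  define \<delta> where "\<delta> = min \<epsilon> \<epsilon>'"
  have "\<delta> > 0" using \<epsilon>(1) \<epsilon>'(1) by (simp add: \<delta>_def)
  have "smooth_on {- \<delta> <..< \<delta>} G"
    unfolding G_def by (intro smooth_on_intertwiner smooth_on_subset[OF \<epsilon>(2)] smooth_on_subset[OF \<epsilon>'(2)]) (auto simp: \<delta>_def)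
  then have "G differentiable (at 0)" by (rule smooth_on_differentiable) (use \<open>\<delta> > 0\<close> in auto)
  then obtain G' where G': "(G has_vector_derivative G') (at 0)"
    by (auto simp: vector_derivative_works)
  have "\<forall>\<^sub>F t in nhds 0. \<exists>w x y z. G t = quat w x y z"
    using ev2
  proof eventually_elim
    case (elim t)
    then obtain r k h where "k \<in> SU2" "h \<in> SU2" and G: "G t = r *\<^sub>R (k ** matrix_inv h)"
      by blast
    then have "k ** matrix_inv h \<in> SU2"
      by (simp add: SU2_mult SU2_inv)
    with G show ?case by (auto simp: mem_SU2_iff)
  qed
  then obtain w x y z where "G' = quat w x y z" using quat_has_vector_derivative[OF G'] by blast
  moreover obtain w' x' y' z' where "matrix_inv g0 = quat w' x' y' z'"
    using SU2_inv(1)[OF g0] by (auto simp: mem_SU2_iff)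
  ultimately obtain r x1 x2 x3 where "(1 / \<kappa>) *\<^sub>R (G' ** matrix_inv g0) = quat r x1 x2 x3" by auto
  then have \<xi>: "quat 0 x1 x2 x3 + r *\<^sub>R mat 1 = (1 / \<kappa>) *\<^sub>R (G' ** matrix_inv g0)"
    by (simp add: mat_1_eq_quat)
  define \<xi> where "\<xi> = quat 0 x1 x2 x3"
  \<comment> \<open>The four entries share one intertwiner, hence one \<xi>, as a common orbit
    direction requires.\<close>
  have comp: "L ?d = mconj g0 (L ?e) + (\<xi> ** mconj g0 (L (e 0)) - mconj g0 (L (e 0)) ** \<xi>)"
    if L: "bounded_linear L" and conj: "\<And>k x. L (conj_act k x) = mconj k (L x)" for L :: "quad \<Rightarrow> mat2"
  proof (rule derivative_of_intertwined[OF _ _ G' _ g0 \<kappa>(2,1)])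
    show "((\<lambda>t. L (d t)) has_vector_derivative L ?d) (at 0)" "((\<lambda>t. L (e t)) has_vector_derivative L ?e) (at 0)"
      by (intro bounded_linear.has_vector_derivative[OF L] D E)+
    show "\<forall>\<^sub>F t in nhds 0. L (d t) ** G t = G t ** L (e t)"
      using ev2
    proof eventually_elim
      case (elim t)
      then obtain r k h x where k: "k \<in> SU2" and h: "h \<in> SU2" and G: "G t = r *\<^sub>R (k ** matrix_inv h)"
        and dx: "d t = conj_act k x" and ex: "e t = conj_act h x" by blast
      have "mconj k (L x) ** (k ** matrix_inv h) = k ** matrix_inv h ** mconj h (L x)"
        using mconj_mult_cancel(1)[OF k, of "L x" "matrix_inv h"] mconj_mult_cancel(2)[OF h, of k "L x"]
        by (simp add: matrix_mul_assoc)
      then show ?case by (simp add: dx ex conj G mmul.scaleR_left mmul.scaleR_right)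
    qed
    show "\<xi> + r *\<^sub>R mat 1 = (1 / \<kappa>) *\<^sub>R (G' ** matrix_inv g0)" by (simp add: \<xi>_def \<xi>)
  qed
  have "bounded_linear (\<lambda>x :: quad. fst (snd x))" "bounded_linear (\<lambda>x :: quad. fst (snd (snd x)))"
    "bounded_linear (\<lambda>x :: quad. snd (snd (snd x)))"
    by (intro bounded_linear_fst_comp bounded_linear_snd_comp bounded_linear_ident)+
  note bl = bounded_linear_fst this
  obtain e1 e2 e3 e4 where e4: "e 0 = (e1, e2, e3, e4)" by (cases "e 0")
  obtain e1' e2' e3' e4' where e4': "?e = (e1', e2', e3', e4')" by (cases ?e)
  have "?d = conj_act g0 ?e + inf_conj \<xi> (conj_act g0 (e 0))"
    using comp[OF bl(1)] comp[OF bl(2)] comp[OF bl(3)] comp[OF bl(4)]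
    by (cases ?d) (simp add: e4 e4' conj_act_eq inf_conj_def split_paired_all)
  moreover have "\<xi> \<in> su2" by (simp add: \<xi>_def)
  ultimately show ?thesis
    unfolding velocity_def d0 using tangent_class_conj_act[OF g0] by simp
qed


section \<open>The symplectic form\<close>

text \<open>By Cayley-Hamilton the adjugate of a 2 by 2 matrix is tr M - M. Inversion thereby
  becomes a rational expression on an open set of matrices.\<close>

lemma matrix_inv_eq_adjugate:
  fixes M :: mat2
  assumes "det M \<noteq> 0"
  shows "matrix_inv M = mat (inverse (det M)) ** (mat (trace M) - M)" "M ** matrix_inv M = mat 1"
proof -
  let ?N = "mat (inverse (det M)) ** (mat (trace M) - M)"
  have "M $ 1 $ 1 * M $ 2 $ 2 - M $ 1 $ 2 * M $ 2 $ 1 \<noteq> 0" using assms by (simp add: det_2)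
  then have r: "inverse (det M) * (M $ 1 $ 1 * M $ 2 $ 2 - M $ 1 $ 2 * M $ 2 $ 1) = 1"
    by (simp add: det_2)
  have "M ** ?N = mat 1"
    using r by (simp add: vec_eq_iff forall_2 matrix_matrix_mult_def sum_2 mat_def trace_def)
      (intro conjI; algebra)
  then show "matrix_inv M = ?N" "M ** matrix_inv M = mat 1"
    using matrix_inv_unique by metis+
qed

text \<open>The rational formula only provides differentiability; the value of the derivative comes
  from differentiating M M^(-1) = 1. It is needed on the ambient matrix space, where the
  Maurer-Cartan forms are differentiated.\<close>

lemma has_derivative_matrix_inv:
  fixes A :: mat2
  assumes "det A \<noteq> 0"
  shows "(matrix_inv has_derivative (\<lambda>v. - (matrix_inv A ** v ** matrix_inv A))) (at A)"
proof -
  let ?S = "{M :: mat2. det M \<noteq> 0}"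
  have entry: "bounded_linear (\<lambda>M :: mat2. M $ i $ j)" for i j
    by (rule bounded_linear_compose[OF bounded_linear_vec_nth bounded_linear_vec_nth])
  have "open ?S"
    unfolding det_2
    by (intro open_Collect_neq continuous_intros bounded_linear.continuous_on[OF entry])
  have "(\<lambda>M :: mat2. inverse (det M)) differentiable (at A)"
    using assms unfolding det_2
    by (intro differentiable_inverse differentiable_diff differentiable_mult bounded_linear_imp_differentiable entry)
  then obtain r' where r': "((\<lambda>M :: mat2. inverse (det M)) has_derivative r') (at A)"
    by (auto simp: differentiable_def)
  have mat: "bounded_linear (mat :: complex \<Rightarrow> mat2)"
    by (rule linear_conv_bounded_linear[THEN iffD1]) (auto simp: linear_iff mat_def vec_eq_iff)
  have "((\<lambda>M. mat (inverse (det M)) ** (mat (trace M) - M)) has_derivative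
      (\<lambda>v. mat (inverse (det A)) ** (mat (trace v) - v) + mat (r' v) ** (mat (trace A) - A))) (at A)"
    by (intro mmul.FDERIV has_derivative_diff bounded_linear.has_derivative[OF mat] r'
        bounded_linear.has_derivative[OF linear_trace] has_derivative_ident)
  then have "(matrix_inv has_derivative
      (\<lambda>v. mat (inverse (det A)) ** (mat (trace v) - v) + mat (r' v) ** (mat (trace A) - A))) (at A)"
    by (rule has_derivative_transform_within_open[OF _ \<open>open ?S\<close>])
       (use assms in \<open>auto simp: matrix_inv_eq_adjugate\<close>)
  then obtain D where D: "(matrix_inv has_derivative D) (at A)"
    by blast
  have "D v = - (matrix_inv A ** v ** matrix_inv A)" for v
  proof -
    have "((\<lambda>M. M ** matrix_inv M) has_derivative (\<lambda>v. A ** D v + v ** matrix_inv A)) (at A)"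
      by (intro mmul.FDERIV has_derivative_ident D)
    then have "((\<lambda>M. mat 1) has_derivative (\<lambda>v. A ** D v + v ** matrix_inv A)) (at A)"
      by (rule has_derivative_transform_within_open[OF _ \<open>open ?S\<close>])
         (use assms in \<open>auto simp: matrix_inv_eq_adjugate(2)\<close>)
    then have "(\<lambda>v. A ** D v + v ** matrix_inv A) = (\<lambda>v. 0)"
      by (rule has_derivative_unique[OF _ has_derivative_const])
    then have "A ** D v + v ** matrix_inv A = 0"
      by (rule fun_cong)
    then have "A ** D v = - (v ** matrix_inv A)"
      by (rule iffD2[OF eq_neg_iff_add_eq_0])
    then have "matrix_inv A ** A ** D v = - (matrix_inv A ** v ** matrix_inv A)"
      by (simp add: mmul.minus_right flip: matrix_mul_assoc)
    moreover have "matrix_inv A ** A = mat 1"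
      using matrix_inv_eq_adjugate(2)[OF assms] matrix_left_right_inverse by blast
    ultimately show ?thesis by simp
  qed
  then have "D = (\<lambda>v. - (matrix_inv A ** v ** matrix_inv A))" by blast
  with D show ?thesis by simp
qed

lemma matrix_inv_matrix_inv: "g \<in> SU2 \<Longrightarrow> matrix_inv (matrix_inv g) = g"
  by (rule matrix_inv_unique) (rule SU2_inv)

lemma SU2_det: "g \<in> SU2 \<Longrightarrow> det g \<noteq> 0"
  by (simp add: SU2_def)

lemma bounded_linear_quad_proj:
  "bounded_linear (\<lambda>(A, B, a, b). A :: mat2)" "bounded_linear (\<lambda>(A, B, a, b). B :: mat2)"
  "bounded_linear (\<lambda>(A, B, a, b). b :: mat2)"
  unfolding split_beta by (intro bounded_linear_fst_comp bounded_linear_snd_comp bounded_linear_ident)+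

text \<open>\<open>P\<close>, \<open>Q\<close> and \<open>R\<close> are the ambient derivatives of
  the words A B, A^(-1) B^(-1) and A B A^(-1) B^(-1).\<close>

lemma omega_total_eq:
  assumes A: "A \<in> SU2" and B: "B \<in> SU2"
  defines "iA \<equiv> matrix_inv A" and "iB \<equiv> matrix_inv B"
  defines "P \<equiv> \<lambda>(vA, vB, va, vb). A ** vB + vA ** B"
    and "Q \<equiv> \<lambda>(vA, vB, va, vb). - (iA ** (iB ** vB ** iB) + (iA ** vA ** iA) ** iB)"
    and "R \<equiv> \<lambda>(vA, vB, va, vb). - (A ** B ** iA ** (iB ** vB ** iB)) +
        (- (A ** B ** (iA ** vA ** iA)) + (A ** vB + vA ** B) ** iA) ** iB"
  shows "omega_total (A, B, a, b) v w =
     1/2 * (su2_inner (iA ** fst v) (fst (snd w) ** iB) - su2_inner (iA ** fst w) (fst (snd v) ** iB))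
   + 1/2 * (su2_inner (fst v ** iA) (iB ** fst (snd w)) - su2_inner (fst w ** iA) (iB ** fst (snd v)))
   + 1/2 * (su2_inner (iB ** iA ** P v) (Q w ** (B ** A)) - su2_inner (iB ** iA ** P w) (Q v ** (B ** A)))
   + 1/2 * (su2_inner (matrix_inv b ** snd (snd (snd v))) (R w ** (B ** A ** iB ** iA)) -
       su2_inner (matrix_inv b ** snd (snd (snd w))) (R v ** (B ** A ** iB ** iA)))"
proof -
  let ?x = "(A, B, a, b)"
  note pr = bounded_linear_quad_proj[THEN bounded_linear.has_derivative, OF has_derivative_ident]
  have dA: "((\<lambda>(A, B, a, b). A) has_derivative (\<lambda>v. fst v)) (at ?x)"
    and dB: "((\<lambda>(A, B, a, b). B) has_derivative (\<lambda>v. fst (snd v))) (at ?x)"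
    and db: "((\<lambda>(A, B, a, b). b) has_derivative (\<lambda>v. snd (snd (snd v)))) (at ?x)"
    using pr by (simp_all add: case_prod_unfold)
  have inv: "((\<lambda>x. matrix_inv (f x)) has_derivative (\<lambda>v. - (matrix_inv (f ?x) ** f' v ** matrix_inv (f ?x)))) (at ?x)"
    if "(f has_derivative f') (at ?x)" "f ?x \<in> SU2" for f :: "quad \<Rightarrow> mat2" and f'
    using has_derivative_compose[OF that(1) has_derivative_matrix_inv[OF SU2_det[OF that(2)]]] by simp
  have diA: "((\<lambda>(A, B, a, b). matrix_inv A) has_derivative (\<lambda>v. - (iA ** fst v ** iA))) (at ?x)"
    using inv[OF dA] A by (simp add: iA_def case_prod_unfold)
  have diB: "((\<lambda>(A, B, a, b). matrix_inv B) has_derivative (\<lambda>v. - (iB ** fst (snd v) ** iB))) (at ?x)"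
    using inv[OF dB] B by (simp add: iB_def case_prod_unfold)
  have dP: "((\<lambda>(A, B, a, b). A ** B) has_derivative P) (at ?x)"
    using mmul.FDERIV[OF dA dB] by (simp add: P_def case_prod_unfold)
  have dQ: "((\<lambda>(A, B, a, b). matrix_inv A ** matrix_inv B) has_derivative Q) (at ?x)"
    using mmul.FDERIV[OF diA diB]
    by (simp add: Q_def case_prod_unfold iA_def iB_def mmul.minus_left mmul.minus_right)
  have dR: "((\<lambda>(A, B, a, b). A ** B ** matrix_inv A ** matrix_inv B) has_derivative R) (at ?x)"
    using mmul.FDERIV[OF mmul.FDERIV[OF mmul.FDERIV[OF dA dB] diA] diB]
    by (simp add: R_def case_prod_unfold iA_def iB_def mmul.minus_left mmul.minus_right)
  have invs: "matrix_inv (A ** B) = iB ** iA" "matrix_inv (iA ** iB) = B ** A"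
    "matrix_inv (A ** B ** iA ** iB) = B ** A ** iB ** iA"
    unfolding iA_def iB_def
    using A B by (simp_all add: matrix_inv_mult_SU2 SU2_mult SU2_inv matrix_inv_matrix_inv matrix_mul_assoc)
  show ?thesis
    unfolding omega_total_def wedge_inner_def MC_left_def MC_right_def
      frechet_derivative_at[OF dA, symmetric] frechet_derivative_at[OF dB, symmetric]
      frechet_derivative_at[OF db, symmetric] frechet_derivative_at[OF dP, symmetric]
      frechet_derivative_at[OF dQ, symmetric] frechet_derivative_at[OF dR, symmetric]
    using invs by (simp add: iA_def iB_def)
qed

section \<open>Invariance of the form and its value in coordinates\<close>

lemma su2_inner_quat [simp]:
  "su2_inner (quat w x y z) (quat w' x' y' z') = - (w * w' - x * x' - y * y' - z * z')"
  by (simp add: su2_inner_def field_simps)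

lemma su2_inner_mconj:
  assumes "g \<in> SU2"
  shows "su2_inner (mconj g x) (mconj g y) = su2_inner x y"
  using assms by (simp add: su2_inner_def flip: mconj_mult)

lemma omega_total_conj_act:
  assumes g: "g \<in> SU2" and "A \<in> SU2" "B \<in> SU2" "b \<in> SU2"
  shows "omega_total (conj_act g (A, B, a, b)) (conj_act g v) (conj_act g w) = omega_total (A, B, a, b) v w"
proof -
  obtain vA vB va vb where v: "v = (vA, vB, va, vb)" by (cases v)
  obtain wA wB wa wb where w: "w = (wA, wB, wa, wb)" by (cases w)
  note m = mconj_mult[OF g, symmetric] mconj_add[symmetric] mconj_minus[symmetric]
    matrix_inv_mconj[OF g] su2_inner_mconj[OF g]
  show ?thesis
    using assms unfolding v w conj_act_eq
    by (simp only: omega_total_eq mconj_SU2 m prod.case fst_conv snd_conv)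
qed

text \<open>Writing tangent vectors as A X and B Y leaves only X, Y and the adjoint action in the
  first three terms. \<open>Z\<close> is the derivative of the commutator of A and B, translated
  back to the identity from the right.\<close>

lemma omega_total_left_trivialized:
  assumes A: "A \<in> SU2" and B: "B \<in> SU2"
  defines "Z \<equiv> \<lambda>X Y. mconj (A ** B) (Y - mconj (matrix_inv A) Y - X + mconj (matrix_inv B) X)"
  shows "omega_total (A, B, a, b) (A ** X, B ** Y, va, vb) (A ** X', B ** Y', wa, wb) =
     1/2 * (su2_inner X (mconj B Y') - su2_inner X' (mconj B Y))
   + 1/2 * (su2_inner (mconj A X) Y' - su2_inner (mconj A X') Y)
   + 1/2 * (su2_inner (Y + mconj (matrix_inv B) X) (- (mconj (matrix_inv A) Y' + X')) -
       su2_inner (Y' + mconj (matrix_inv B) X') (- (mconj (matrix_inv A) Y + X)))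
   + 1/2 * (su2_inner (matrix_inv b ** vb) (Z X' Y') - su2_inner (matrix_inv b ** wb) (Z X Y))"
proof -
  let ?A = "matrix_inv A" and ?B = "matrix_inv B"
  note assoc = matrix_mul_assoc[symmetric]
  have cancel: "?A ** (A ** M) = M" "A ** (?A ** M) = M" "?B ** (B ** M) = M" "B ** (?B ** M) = M"
    "?A ** A = mat 1" "A ** ?A = mat 1" "?B ** B = mat 1" "B ** ?B = mat 1" for M
    using A B by (simp_all add: matrix_mul_assoc SU2_inv)
  have inv: "matrix_inv ?A = A" "matrix_inv ?B = B"
    using A B by (simp_all add: matrix_inv_matrix_inv)
  note simps = assoc cancel inv mconj_def mmul.add_left mmul.add_right mmul.diff_left mmul.diff_right
    mmul.minus_left mmul.minus_right matrix_inv_mult_SU2[OF A B]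
  have P: "?B ** ?A ** (A ** (B ** Y) + A ** X ** B) = Y + mconj ?B X" for X Y
    by (simp add: simps)
  have Q: "- (?A ** (?B ** (B ** Y) ** ?B) + (?A ** (A ** X) ** ?A) ** ?B) ** (B ** A) = - (mconj ?A Y + X)" for X Y
    by (simp add: simps)
  have R: "(- (A ** B ** ?A ** (?B ** (B ** Y) ** ?B)) +
      (- (A ** B ** (?A ** (A ** X) ** ?A)) + (A ** (B ** Y) + A ** X ** B) ** ?A) ** ?B) ** (B ** A ** ?B ** ?A) = Z X Y" for X Y
    unfolding Z_def by (simp add: simps)
  have S: "?A ** (A ** X) = X" "B ** Y ** ?B = mconj B Y" "A ** X ** ?A = mconj A X" "?B ** (B ** Y) = Y" for X Y
    by (simp_all add: simps)
  show ?thesis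
    by (subst omega_total_eq[OF A B]) (simp only: prod.case fst_conv snd_conv P Q R, simp only: S)
qed

lemma mconj_rotation:
  "mconj (quat (cos \<alpha>) 0 0 (sin \<alpha>)) (quat 0 x y z) =
    quat 0 (x * cos (2 * \<alpha>) - y * sin (2 * \<alpha>)) (x * sin (2 * \<alpha>) + y * cos (2 * \<alpha>)) z"
  by (simp add: mconj_quat cos_double sin_double, intro conjI;
      (algebra | (insert sin_cos_squared_add[of \<alpha>], algebra)))

text \<open>Left translated to the identity, the orbit direction of \<xi> at e^(\<alpha> k) is its
  conjugate by e^(-\<alpha> k) minus \<xi>: a rotation by -2 \<alpha> about k minus the identity. It
  has no k component, so \<open>s\<close> stays separate.\<close>

lemma left_trivialized_tangent:
  "quat (- s * sin \<alpha>) 0 0 (s * cos \<alpha>) +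
    (quat 0 x y z ** quat (cos \<alpha>) 0 0 (sin \<alpha>) - quat (cos \<alpha>) 0 0 (sin \<alpha>) ** quat 0 x y z) =
   quat (cos \<alpha>) 0 0 (sin \<alpha>) ** quat 0 (x * (cos (2 * \<alpha>) - 1) + y * sin (2 * \<alpha>))
      (y * (cos (2 * \<alpha>) - 1) - x * sin (2 * \<alpha>)) s"
  using sin_cos_squared_add[of \<alpha>]
  by (simp add: cos_double sin_double, intro conjI; algebra)

text \<open>Rotations about k keep the k axis apart from the plane of i and j. Orbit directions
  enter the A and B components only through that plane, where their contributions cancel; the k
  components give the area form.\<close>

lemma omega_total_torus_rep:
  assumes "\<xi> \<in> su2" "\<eta> \<in> su2"
  shows "omega_total (torus_rep u) (torus_rep_deriv u s + inf_conj \<xi> (torus_rep u))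
      (torus_rep_deriv u t + inf_conj \<eta> (torus_rep u)) = fst s * snd t - snd s * fst t"
proof -
  obtain \<alpha> \<beta> where u: "u = (\<alpha>, \<beta>)" by (cases u)
  obtain s1 s2 where s: "s = (s1, s2)" by (cases s)
  obtain t1 t2 where t: "t = (t1, t2)" by (cases t)
  obtain x y z where \<xi>: "\<xi> = quat 0 x y z" using assms by (auto simp: mem_su2_iff)
  obtain x' y' z' where \<eta>: "\<eta> = quat 0 x' y' z'" using assms by (auto simp: mem_su2_iff)
  let ?e = "\<lambda>\<alpha>. quat (cos \<alpha>) 0 0 (sin \<alpha>)"
  let ?L = "\<lambda>\<alpha> s x y. quat 0 (x * (cos (2 * \<alpha>) - 1) + y * sin (2 * \<alpha>)) (y * (cos (2 * \<alpha>) - 1) - x * sin (2 * \<alpha>)) s"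
  let ?b = "quat 0 (- 1) 0 0"
  have v: "torus_rep_deriv u (s1, s2) + inf_conj (quat 0 x y z) (torus_rep u) =
      (?e \<alpha> ** ?L \<alpha> s1 x y, ?e \<beta> ** ?L \<beta> s2 x y, quat 0 x y z ** quat 0 1 0 0 - quat 0 1 0 0 ** quat 0 x y z,
       quat 0 x y z ** ?b - ?b ** quat 0 x y z)" for s1 s2 x y z
    unfolding left_trivialized_tangent[where s = s1 and z = z, symmetric] left_trivialized_tangent[where s = s2 and z = z, symmetric]
    by (simp only: u torus_rep_deriv_def torus_rep_eq inf_conj_def prod.case add_Pair add_0)
  have e: "?e \<alpha> \<in> SU2" "matrix_inv (?e \<alpha>) = ?e (- \<alpha>)" "?e \<alpha> ** ?e \<beta> = ?e (\<alpha> + \<beta>)" for \<alpha> \<beta>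
    by (simp_all add: matrix_inv_quat cos_add sin_add)
  \<comment> \<open>The plane parts come from one vector by rotations about k minus the identity,
    and such rotations commute. Hence the commutator of A and B is stationary and the last term of
    the form vanishes.\<close>
  have Z: "?L \<beta> s2 x y - mconj (?e (- \<alpha>)) (?L \<beta> s2 x y) - ?L \<alpha> s1 x y + mconj (?e (- \<beta>)) (?L \<alpha> s1 x y) = quat 0 0 0 0" for s1 s2 x y
    unfolding mconj_rotation by (simp add: algebra_simps)
  have Z': "mconj g (quat 0 0 0 0) = quat 0 0 0 0" for g
    by (simp add: mconj_def flip: zero_eq_quat)
  have inner_0: "su2_inner M (quat 0 0 0 0) = 0" for M
    by (simp add: su2_inner_def trace_def flip: zero_eq_quat)
  show ?thesis
    unfolding s t \<xi> \<eta> v unfolding u torus_rep_eq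
    unfolding omega_total_left_trivialized[OF e(1) e(1)] e(2) Z
    unfolding mconj_rotation Z' inner_0
    by (simp add: field_simps)
      (use sin_cos_squared_add[of "\<alpha> * 2"] sin_cos_squared_add[of "\<beta> * 2"] in algebra)
qed

text \<open>The stabilizer of \<^term>\<open>torus_rep u\<close> is \<open>{1, - 1}\<close>.\<close>

lemma torus_rep_stabilizer:
  assumes u: "u \<in> coord_dom" and k: "k \<in> SU2" and stab: "conj_act k (torus_rep u) = torus_rep u"
  shows "conj_act k v = v"
proof -
  obtain \<alpha> \<beta> where ueq: "u = (\<alpha>, \<beta>)" by (cases u)
  obtain w x y z where kq: "k = quat w x y z" and n: "w\<^sup>2 + x\<^sup>2 + y\<^sup>2 + z\<^sup>2 = 1"
    using k by (auto simp: mem_SU2_iff)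
  have comm: "k ** m = m ** k" if "mconj k m = m" for m
  proof -
    have "k ** m = k ** m ** matrix_inv k ** k"
      using k by (simp add: SU2_inv flip: matrix_mul_assoc)
    also have "\<dots> = m ** k"
      using that by (simp add: mconj_def)
    finally show ?thesis .
  qed
  have "k ** quat 0 1 0 0 = quat 0 1 0 0 ** k" "k ** quat (cos \<alpha>) 0 0 (sin \<alpha>) = quat (cos \<alpha>) 0 0 (sin \<alpha>) ** k"
    "k ** quat (cos \<beta>) 0 0 (sin \<beta>) = quat (cos \<beta>) 0 0 (sin \<beta>) ** k"
    using stab by (auto intro!: comm simp: ueq torus_rep_eq conj_act_eq)
  \<comment> \<open>Commuting with i removes the j and k coefficients; commuting with A or B,
    whichever has nonzero sine, removes the i coefficient.\<close>
  then have "y = 0" "z = 0" "x = 0"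
    using u by (auto simp: kq ueq coord_dom_def)
  then have kw: "k = w *\<^sub>R mat 1" and w: "w * w = 1"
    using n by (simp_all add: kq mat_1_eq_quat power2_eq_square)
  have "matrix_inv k = k"
    by (rule matrix_inv_unique) (simp add: kw mmul.scaleR_left mmul.scaleR_right w)
  then have "mconj k m = m" for m
    by (simp add: mconj_def) (simp add: kw mmul.scaleR_left mmul.scaleR_right w)
  then show ?thesis by (cases v) (simp add: conj_act_eq)
qed

text \<open>Two representatives over one point \<open>x\<close> may come from different conjugations
  \<open>g\<close> and \<open>h\<close>. These differ by a stabilizing element, which acts
  trivially, so both vectors are pulled back by the same \<open>g\<close> and only orbit directions
  remain.\<close>

lemma omega_total_tangent_class:
  assumes u: "u \<in> coord_dom"
    and v: "(x, v) \<in> tangent_class (torus_rep u) (torus_rep_deriv u s)"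
    and w: "(x, w) \<in> tangent_class (torus_rep u) (torus_rep_deriv u t)"
  shows "omega_total x v w = fst s * snd t - snd s * fst t"
proof -
  let ?T = "torus_rep u"
  obtain g \<xi> where g: "g \<in> SU2" and \<xi>: "\<xi> \<in> su2" and x: "x = conj_act g ?T"
    and v: "v = conj_act g (torus_rep_deriv u s) + inf_conj \<xi> x"
    using v by (auto simp: tangent_class_def)
  obtain h \<eta> where h: "h \<in> SU2" and \<eta>: "\<eta> \<in> su2" and x': "x = conj_act h ?T"
    and w: "w = conj_act h (torus_rep_deriv u t) + inf_conj \<eta> x"
    using w by (auto simp: tangent_class_def)
  have "conj_act (matrix_inv g ** h) ?T = conj_act (matrix_inv g) (conj_act h ?T)"
    using g h by (simp add: conj_act_conj_act SU2_inv)
  also have "\<dots> = ?T" using g by (simp flip: x' add: x)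
  finally have "conj_act (matrix_inv g ** h) m = m" for m
    using torus_rep_stabilizer[OF u] g h by (simp add: SU2_mult SU2_inv)
  then have "conj_act g (conj_act (matrix_inv g ** h) m) = conj_act g m" for m
    by simp
  then have hg: "conj_act h m = conj_act g m" for m
    using g h by (simp add: conj_act_conj_act SU2_inv SU2_mult matrix_mul_assoc)
  have pull: "conj_act g m + inf_conj \<zeta> x = conj_act g (m + inf_conj (mconj (matrix_inv g) \<zeta>) ?T)" for m \<zeta>
    using g by (simp add: conj_act_add conj_act_inf_conj x)
  have su: "mconj (matrix_inv g) \<xi> \<in> su2" "mconj (matrix_inv g) \<eta> \<in> su2"
    using g \<xi> \<eta> by (simp_all add: mconj_su2 SU2_inv)
  obtain \<alpha> \<beta> where ueq: "u = (\<alpha>, \<beta>)" by (cases u)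
  have "omega_total x v w = omega_total ?T (torus_rep_deriv u s + inf_conj (mconj (matrix_inv g) \<xi>) ?T)
      (torus_rep_deriv u t + inf_conj (mconj (matrix_inv g) \<eta>) ?T)"
    unfolding v w hg pull unfolding x ueq torus_rep_eq by (rule omega_total_conj_act[OF g]) simp_all
  then show ?thesis
    using omega_total_torus_rep[OF su] by simp
qed

lemma torus_form_eq:
  assumes "u \<in> coord_dom"
  shows "torus_form (tangent_class (torus_rep u) (torus_rep_deriv u s))
    (tangent_class (torus_rep u) (torus_rep_deriv u t)) = fst s * snd t - snd s * fst t"
  unfolding torus_form_def
proof (rule the_equality)
  let ?v = "torus_rep_deriv u s" and ?w = "torus_rep_deriv u t"
  have "omega_total (torus_rep u) ?v ?w = fst s * snd t - snd s * fst t"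
    by (rule omega_total_tangent_class[OF assms]) (rule self_in_tangent_class)+
  then show "\<exists>x v w. (x, v) \<in> tangent_class (torus_rep u) ?v \<and> (x, w) \<in> tangent_class (torus_rep u) ?w \<and>
      fst s * snd t - snd s * fst t = omega_total x v w"
    using self_in_tangent_class by metis
qed (use omega_total_tangent_class[OF assms] in blast)

text \<open>Comparing with the form on the torus side shows that the value does not depend on the coordinates.\<close>

lemma pillow_form_eq:
  assumes "u \<in> coord_dom"
  shows "pillow_form (tangent_class (pillow_rep u) (pillow_rep_deriv u s))
    (tangent_class (pillow_rep u) (pillow_rep_deriv u t)) = fst s * snd t - snd s * fst t"
  unfolding pillow_form_def frechet_derivative_pillow_rep
proof (rule the_equality)
  let ?p = "\<lambda>u s. tangent_class (pillow_rep u) (pillow_rep_deriv u s)"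
  let ?q = "\<lambda>u s. tangent_class (torus_rep u) (torus_rep_deriv u s)"
  show "\<exists>u'\<in>coord_dom. \<exists>s' t'. ?p u s = ?p u' s' \<and> ?p u t = ?p u' t' \<and>
      fst s * snd t - snd s * fst t = fst s' * snd t' - snd s' * fst t'"
    using assms by blast
  fix r assume "\<exists>u'\<in>coord_dom. \<exists>s' t'. ?p u s = ?p u' s' \<and> ?p u t = ?p u' t' \<and>
      r = fst s' * snd t' - snd s' * fst t'"
  then obtain u' s' t' where u': "u' \<in> coord_dom" and eq: "?p u s = ?p u' s'" "?p u t = ?p u' t'"
    and r: "r = fst s' * snd t' - snd s' * fst t'"
    by blast
  have "?q u s = ?q u' s'" "?q u t = ?q u' t'"
    using eq[THEN pillow_to_torus_deriv_cong] by (simp_all add: pillow_to_torus_rep pillow_to_torus_rep_deriv)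
  then have "torus_form (?q u s) (?q u t) = torus_form (?q u' s') (?q u' t')"
    by simp
  then show "r = fst s * snd t - snd s * fst t"
    by (simp add: torus_form_eq assms u' r)
qed

section \<open>The derivative of the map\<close>

lemma smooth_curve_pillow_to_torus:
  assumes c: "smooth_curve_in (\<Union>R_star_S24) c"
  shows "smooth_curve_in (\<Union>R2_star_T22) (\<lambda>t. pillow_to_torus (c t))"
    and "velocity (\<lambda>t. pillow_to_torus (c t)) =
      tangent_class (pillow_to_torus (c 0)) (pillow_to_torus_deriv (c 0) (vector_derivative c (at 0)))"
proof -
  obtain \<epsilon> where \<epsilon>: "\<epsilon> > 0" "smooth_on {- \<epsilon> <..< \<epsilon>} c" "c ` {- \<epsilon> <..< \<epsilon>} \<subseteq> \<Union>R_star_S24"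
    unfolding smooth_curve_in_def using c[unfolded smooth_curve_in_def] by blast
  have "smooth_on {- \<epsilon> <..< \<epsilon>} (\<lambda>t. pillow_to_torus (c t))"
    using \<epsilon>(2) by (intro smooth_on_pillow_to_torus) simp_all
  moreover have "pillow_to_torus (c t) \<in> \<Union>R2_star_T22" if "t \<in> {- \<epsilon> <..< \<epsilon>}" for t
    using \<epsilon>(3) imageI[OF that, of c] by (intro pillow_to_torus_mem) (rule subsetD)
  ultimately show "smooth_curve_in (\<Union>R2_star_T22) (\<lambda>t. pillow_to_torus (c t))"
    unfolding smooth_curve_in_def using \<epsilon>(1) by (intro exI[of _ \<epsilon>] conjI image_subsetI)
  let ?D = "pillow_to_torus_deriv (c 0)"
  have "((\<lambda>t. pillow_to_torus (c t)) has_derivative (\<lambda>t. ?D (t *\<^sub>R vector_derivative c (at 0)))) (at 0)"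
    using smooth_curve_in_derivative(1)[OF c] has_derivative_pillow_to_torus
    unfolding has_vector_derivative_def by (rule has_derivative_compose)
  moreover have "?D (t *\<^sub>R v) = t *\<^sub>R ?D v" for t v
    using has_derivative_linear[OF has_derivative_pillow_to_torus] by (rule linear_cmul)
  ultimately have "((\<lambda>t. pillow_to_torus (c t)) has_vector_derivative ?D (vector_derivative c (at 0))) (at 0)"
    by (simp add: has_vector_derivative_def)
  then show "velocity (\<lambda>t. pillow_to_torus (c t)) =
      tangent_class (pillow_to_torus (c 0)) (?D (vector_derivative c (at 0)))"
    by (simp add: velocity_def vector_derivative_at)
qed

text \<open>Existence uses the composed curve as lift. Uniqueness must allow any curve with velocity
  \<open>p\<close> and any other lift of its image: the first choice is harmless because the
  derivative descends to tangent classes, the second by the comparison of curves with equal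
  conjugacy classes.\<close>

lemma tangent_map_pillow_torus_map:
  assumes u: "u \<in> coord_dom" and p: "p \<in> tangent_space R_star_S24 (conj_class (pillow_rep u))"
    and ps: "p = tangent_class (pillow_rep u) (pillow_rep_deriv u s)"
  shows "tangent_map R_star_S24 R2_star_T22 pillow_torus_map p =
    tangent_class (torus_rep u) (torus_rep_deriv u s)"
proof -
  have push: "velocity (\<lambda>t. pillow_to_torus (c t)) = tangent_class (torus_rep u) (torus_rep_deriv u s)"
    if c: "smooth_curve_in (\<Union>R_star_S24) c" and "p = velocity c" for c
  proof -
    have "tangent_class (c 0) (vector_derivative c (at 0)) = tangent_class (pillow_rep u) (pillow_rep_deriv u s)"
      using that ps by (simp add: velocity_def)
    from pillow_to_torus_deriv_cong[OF this] show ?thesis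
      by (simp add: smooth_curve_pillow_to_torus[OF c] pillow_to_torus_rep pillow_to_torus_rep_deriv)
  qed
  obtain c where c: "smooth_curve_in (\<Union>R_star_S24) c" "p = velocity c"
    using p by (auto simp: tangent_space_def)
  show ?thesis
    unfolding tangent_map_def
  proof (rule the_equality)
    show "\<exists>c d. smooth_curve_in (\<Union>R_star_S24) c \<and> smooth_curve_in (\<Union>R2_star_T22) d \<and>
        (\<forall>\<^sub>F t in nhds 0. pillow_torus_map (conj_class (c t)) = conj_class (d t)) \<and>
        p = velocity c \<and> tangent_class (torus_rep u) (torus_rep_deriv u s) = velocity d"
      using c push[OF c] smooth_curve_pillow_to_torus(1)[OF c(1)]
      by (intro exI[of _ c] exI[of _ "\<lambda>t. pillow_to_torus (c t)"]) (simp add: pillow_torus_map_conj_class)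
  next
    fix q assume "\<exists>c d. smooth_curve_in (\<Union>R_star_S24) c \<and> smooth_curve_in (\<Union>R2_star_T22) d \<and>
        (\<forall>\<^sub>F t in nhds 0. pillow_torus_map (conj_class (c t)) = conj_class (d t)) \<and> p = velocity c \<and> q = velocity d"
    then obtain c d where c: "smooth_curve_in (\<Union>R_star_S24) c" and d: "smooth_curve_in (\<Union>R2_star_T22) d"
      and ev: "\<forall>\<^sub>F t in nhds 0. pillow_torus_map (conj_class (c t)) = conj_class (d t)"
      and p: "p = velocity c" and q: "q = velocity d"
      by blast
    have "\<forall>\<^sub>F t in nhds 0. conj_class (d t) = conj_class (pillow_to_torus (c t))"
      using ev by eventually_elim (simp add: pillow_torus_map_conj_class)
    then have "velocity d = velocity (\<lambda>t. pillow_to_torus (c t))"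
      by (rule velocity_eq_if_conj_class_eq[OF d smooth_curve_pillow_to_torus(1)[OF c]])
    then show "q = tangent_class (torus_rep u) (torus_rep_deriv u s)"
      using push[OF c p] q by simp
  qed
qed

theorem theorem3p5:
  shows "\<exists>F. (\<forall>\<gamma> \<theta>. (\<gamma>, \<theta>) \<in> coord_dom \<longrightarrow>
                F (conj_class (pillow_rep (\<gamma>, \<theta>))) = conj_class (torus_rep (\<gamma>, \<theta>))) \<and>
             is_symplectomorphism R_star_S24 pillow_form R2_star_T22 torus_form F"
proof (intro exI[of _ pillow_torus_map] conjI)
  show "\<forall>\<gamma> \<theta>. (\<gamma>, \<theta>) \<in> coord_dom \<longrightarrow>
      pillow_torus_map (conj_class (pillow_rep (\<gamma>, \<theta>))) = conj_class (torus_rep (\<gamma>, \<theta>))"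
    by (simp add: pillow_torus_map_conj_class pillow_to_torus_rep)
  have "torus_form (tangent_map R_star_S24 R2_star_T22 pillow_torus_map p)
      (tangent_map R_star_S24 R2_star_T22 pillow_torus_map q) = pillow_form p q"
    if m: "m \<in> R_star_S24" and p: "p \<in> tangent_space R_star_S24 m" and q: "q \<in> tangent_space R_star_S24 m" for m p q
  proof -
    obtain u where u: "u \<in> coord_dom" and "m = conj_class (pillow_rep u)"
      using m by (auto simp: R_star_S24_eq)
    then have p: "p \<in> tangent_space R_star_S24 (conj_class (pillow_rep u))"
      and q: "q \<in> tangent_space R_star_S24 (conj_class (pillow_rep u))"
      using p q by simp_all
    obtain s where s: "p = tangent_class (pillow_rep u) (pillow_rep_deriv u s)"
      using u p by (rule tangent_space_pillow)
    obtain t where t: "q = tangent_class (pillow_rep u) (pillow_rep_deriv u t)"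
      using u q by (rule tangent_space_pillow)
    show ?thesis
      unfolding tangent_map_pillow_torus_map[OF u p s] tangent_map_pillow_torus_map[OF u q t]
      unfolding s t by (simp add: torus_form_eq pillow_form_eq u)
  qed
  then show "is_symplectomorphism R_star_S24 pillow_form R2_star_T22 torus_form pillow_torus_map"
    unfolding is_symplectomorphism_def using is_diffeomorphism_pillow_torus_map by blast
qed

end
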